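(* Let $N$ be an integer with $4\le N\le 10$. The equation $$\Delta U+e^{U}=0\quad\text{in }\ \mathbb{R}^N\setminus\{0\}$$ has countably infinitely many (i.e. a sequence of pairwise distinct) nonradial classical solutions of the form $$U(R,\sigma)=-2\log R+\log\bigl(2(N-2)\bigr)+V(\sigma),\qquad (R,\sigma)\in(0,\infty)\times\mathbb{S}^{N-1},$$ where $V$ is a nonconstant smooth function on $\mathbb{S}^{N-1}$, such that these solutions diverge at the origin.
   Context: $\mathbb{S}^{N-1}$ is the unit sphere in $\mathbb{R}^N$, and $(R,\sigma)\in(0,\infty)\times\mathbb{S}^{N-1}$ are spherical polar coordinates on $\mathbb{R}^N\setminus\{0\}$, i.e. $x=R\sigma$ with $R=|x|$. A classical solution is a $C^2$ function on $\mathbb{R}^N\setminus\{0\}$ satisfying the equation pointwise. Nonradial means not a function of $R=|x|$ alone. *)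

theory Defs
  imports "HOL-Analysis.Analysis"
begin

definition partial_deriv :: "'n::finite \<Rightarrow> (real^'n \<Rightarrow> real) \<Rightarrow> real^'n \<Rightarrow> real" where
  "partial_deriv i f x = frechet_derivative f (at x) (axis i 1)"

definition laplacian :: "(real^'n::finite \<Rightarrow> real) \<Rightarrow> real^'n \<Rightarrow> real" where
  "laplacian f x = (\<Sum>i\<in>UNIV. partial_deriv i (partial_deriv i f) x)"

text \<open>
  Functions of class C^k on S, meant for open S only. The value of
  \<^const>\<open>frechet_derivative\<close> is unspecified where the function is not differentiable,
  so differentiability is required before the partial derivatives are used; on an open set this
  is the usual class of functions with continuous partial derivatives up to order k.
\<close>
fun C_k_on :: "nat \<Rightarrow> (real^'n::finite \<Rightarrow> real) \<Rightarrow> (real^'n) set \<Rightarrow> bool" where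
  "C_k_on 0 f S \<longleftrightarrow> continuous_on S f"
| "C_k_on (Suc k) f S \<longleftrightarrow>
     (\<forall>x\<in>S. f differentiable (at x)) \<and> (\<forall>i. C_k_on k (partial_deriv i f) S)"

text \<open>
  Smoothness on the unit sphere as an embedded submanifold: locally, the function is the
  restriction of a smooth function on an open subset of the ambient space. Values of V off the
  sphere play no role.
\<close>
definition smooth_on_sphere :: "(real^'n::finite \<Rightarrow> real) \<Rightarrow> bool" where
  "smooth_on_sphere V \<longleftrightarrow>
     (\<forall>p\<in>sphere 0 1. \<exists>W g. open W \<and> p \<in> W \<and> (\<forall>k. C_k_on k g W) \<and>
        (\<forall>\<sigma>\<in>W \<inter> sphere 0 1. g \<sigma> = V \<sigma>))"

text \<open>
  Functions on the punctured space are represented by total functions; the value at 0 is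
  irrelevant in all of the following.
\<close>
definition classical_solution :: "(real^'n::finite \<Rightarrow> real) \<Rightarrow> bool" where
  "classical_solution U \<longleftrightarrow>
     C_k_on 2 U (- {0}) \<and> (\<forall>x. x \<noteq> 0 \<longrightarrow> laplacian U x + exp (U x) = 0)"

definition radial :: "(real^'n::finite \<Rightarrow> real) \<Rightarrow> bool" where
  "radial U \<longleftrightarrow> (\<exists>\<phi>. \<forall>x. x \<noteq> 0 \<longrightarrow> U x = \<phi> (norm x))"

end

theory Submission
  imports Defs
begin

text \<open>
  Put \<open>m = N - 3\<close>. We look for \<open>V\<close> depending only on the polar angle and symmetric about the equator, and
  shoot from the pole with \<open>V = a\<close>; a solution is obtained whenever the derivative vanishes at the
  equator. The equation has the explicit singular solution
  \<open>V\<^sub>0 = - 2 ln (sin \<theta>) + ln (m / (m + 1))\<close>, which is itself symmetric about the equator. With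
  \<open>cos \<theta> = - tanh t\<close> the difference \<open>w = V - V\<^sub>0\<close> satisfies
  \<open>w'' = m tanh t w' - 2 m (exp w - 1)\<close> on \<open>t \<le> 0\<close>, a damped oscillator. As \<open>a\<close> grows, the orbit of
  \<open>(w, w')\<close> starts within a fixed compact set at times tending to \<open>-\<infinity>\<close>, is drawn into a neighbourhood of
  the origin after a bounded time, and there rotates at a speed bounded below because \<open>m \<le> 7\<close>. Its angle
  at the equator is therefore a continuous function of \<open>a\<close> tending to \<open>-\<infinity>\<close>, and \<open>w' = V'\<close> vanishes at
  the equator each time this angle is a multiple of \<open>\<pi>\<close>.
\<close>

section \<open>The initial value problem at the pole\<close>

text \<open>The pole corresponds to \<open>t = -\<infinity>\<close>, so orbits with different
  \<open>a\<close> cannot be compared there. They become comparable where \<open>r\<close> is of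
  order \<open>exp (- a)\<close>: up to that point \<open>V\<close> has dropped from
  \<open>a\<close> by a bounded amount only, while \<open>V\<^sub>0\<close> has come down to
  \<open>a\<close> up to a bounded amount, so \<open>w\<close> is of order one uniformly in
  \<open>a\<close>. The remaining interval in \<open>t\<close> has length about
  \<open>a / 2\<close>, and all of it except a part of bounded length is spent rotating. The origin
  attracts because the friction \<open>m * tanh t\<close> has the right sign for
  \<open>t < 0\<close>. The limiting linear equation \<open>w'' + m w' + 2 m w = 0\<close> has
  discriminant \<open>m\<^sup>2 - 8 m\<close>, which is negative for \<open>m\<close> between 1 and
  7; \<open>m\<close> at least 1 is also what gives a meaning to the logarithm in
  \<open>V\<^sub>0\<close>. Two points need care for smoothness of \<open>V\<close>: the pole, where
  the equation degenerates and an averaged integral form replaces it, and the equator, where the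
  solution is continued by reflection and uniqueness shows that the continuation is the solution
  itself.\<close>

definition avg :: "nat \<Rightarrow> (real \<Rightarrow> real) \<Rightarrow> real \<Rightarrow> real" where
  "avg p g r = integral {0..1} (\<lambda>s. s ^ p * g (r * s\<^sup>2))"

text \<open>The primitive of \<open>g\<close> that vanishes at 0. The fixed interval of integration
  avoids a case split on the sign of \<open>r\<close> and reduces joint continuity in
  \<open>r\<close> and a parameter to that of parametric integrals.\<close>

definition prim :: "(real \<Rightarrow> real) \<Rightarrow> real \<Rightarrow> real" where
  "prim g r = r * integral {0..1} (\<lambda>s. g (r * s))"

lemma continuous_on_binary:
  assumes "continuous_on UNIV (\<lambda>z. g (fst z) (snd z))" "continuous_on S p" "continuous_on S q"
  shows "continuous_on S (\<lambda>x. g (p x) (q x))"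
  using continuous_on_compose2[OF assms(1) continuous_on_Pair[OF assms(2,3)]] by simp

lemma continuous_on_avg:
  assumes "continuous_on UNIV (\<lambda>z::real \<times> real. g (fst z) (snd z))"
  shows "continuous_on UNIV (\<lambda>z. avg p (\<lambda>x. g x (snd z)) (fst z))"
proof -
  have "continuous_on (UNIV \<times> cbox 0 1)
      (\<lambda>(z, s). s ^ p * g (fst z * s\<^sup>2) (snd (z::real\<times>real)))"
    unfolding case_prod_unfold by (intro continuous_intros continuous_on_binary[OF assms])
  from integral_continuous_on_param[OF this] show ?thesis
    by (simp add: avg_def)
qed

lemma continuous_on_prim:
  assumes "continuous_on UNIV (\<lambda>z::real \<times> real. g (fst z) (snd z))"
  shows "continuous_on UNIV (\<lambda>z. prim (\<lambda>x. g x (snd z)) (fst z))"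
proof -
  have "continuous_on (UNIV \<times> cbox 0 1)
      (\<lambda>(z, s). g (fst z * s) (snd (z::real\<times>real)))"
    unfolding case_prod_unfold by (intro continuous_intros continuous_on_binary[OF assms])
  from integral_continuous_on_param[OF this] show ?thesis
    by (auto simp: prim_def intro!: continuous_intros)
qed

lemma continuous_on_slice:
  assumes "continuous_on UNIV (\<lambda>z. g (fst z) (snd z))"
  shows "continuous_on UNIV (\<lambda>x. g x a)"
  by (intro continuous_on_binary[OF assms] continuous_intros)

lemma integrable_avg:
  assumes "continuous_on UNIV (g :: real \<Rightarrow> real)"
  shows "(\<lambda>s. s ^ p * g (r * s\<^sup>2)) integrable_on {0..1}"
  by (intro integrable_continuous_interval continuous_intros continuous_on_compose2[OF assms]) auto

lemma integrable_prim:
  assumes "continuous_on UNIV (g :: real \<Rightarrow> real)"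
  shows "(\<lambda>s. g (r * s)) integrable_on {0..1}"
  by (intro integrable_continuous_interval continuous_intros continuous_on_compose2[OF assms]) auto

lemma avg_diff:
  assumes "continuous_on UNIV g" "continuous_on UNIV h"
  shows "avg p g r - avg p h r = avg p (\<lambda>x. g x - h x) r"
  unfolding avg_def
  by (subst integral_diff[symmetric]) (auto intro!: integrable_avg assms simp: algebra_simps)

lemma prim_diff:
  assumes "continuous_on UNIV g" "continuous_on UNIV h"
  shows "prim g r - prim h r = prim (\<lambda>x. g x - h x) r"
  unfolding prim_def right_diff_distrib[symmetric]
  by (subst integral_diff[symmetric]) (auto intro!: integrable_prim assms)

lemma avg_bound:
  assumes "continuous_on UNIV g" "0 \<le> C"
    and le: "\<And>s. s \<in> {0..1} \<Longrightarrow> \<bar>g (r * s\<^sup>2)\<bar> \<le> C"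
  shows "\<bar>avg p g r\<bar> \<le> C"
proof -
  have "norm (integral {0..1} (\<lambda>s. s ^ p * g (r * s\<^sup>2))) \<le> integral {0..1} (\<lambda>s::real. C)"
  proof (rule integral_norm_bound_integral)
    fix s :: real assume s: "s \<in> {0..1}"
    have "s ^ p \<le> 1" "0 \<le> s ^ p" using s by (auto simp: power_le_one)
    then show "norm (s ^ p * g (r * s\<^sup>2)) \<le> C"
      using mult_mono[OF \<open>s ^ p \<le> 1\<close> le[OF s]] by (simp add: abs_mult)
  qed (use assms integrable_avg in auto)
  then show ?thesis by (simp add: avg_def)
qed

text \<open>Integrating the growth bound \<open>exp (l * \<bar>x\<bar>)\<close> gains a factor
  \<open>1 / l\<close>. This gain makes the Picard operator contracting for large
  \<open>l\<close>.\<close>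

lemma prim_bound:
  assumes cont: "continuous_on UNIV g" and "0 < l" "0 \<le> C"
    and le: "\<And>x. \<bar>g x\<bar> \<le> C * exp (l * \<bar>x\<bar>)"
  shows "\<bar>prim g r\<bar> \<le> C / l * exp (l * \<bar>r\<bar>)"
proof (cases "r = 0")
  case False
  define k where "k = l * \<bar>r\<bar>"
  have k: "k > 0" using False assms by (simp add: k_def)
  have I: "((\<lambda>s. C * exp (k * s)) has_integral (C * exp (k * 1) / k - C * exp (k * 0) / k)) {0..1}"
    using k by (intro fundamental_theorem_of_calculus)
      (auto simp: has_real_derivative_iff_has_vector_derivative[symmetric] intro!: derivative_eq_intros)
  have "norm (integral {0..1} (\<lambda>s. g (r * s))) \<le> integral {0..1} (\<lambda>s. C * exp (k * s))"
  proof (rule integral_norm_bound_integral)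
    fix s :: real assume "s \<in> {0..1}"
    then show "norm (g (r * s)) \<le> C * exp (k * s)"
      using le[of "r * s"] by (simp add: k_def abs_mult mult.assoc)
  qed (use I integrable_prim[OF cont] in auto)
  also have "\<dots> = C * (exp k - 1) / k" using integral_unique[OF I] by (simp only: right_diff_distrib diff_divide_distrib mult_1_right mult_zero_right exp_zero)
  also have "\<dots> \<le> C * exp k / k" using k assms by (intro divide_right_mono mult_left_mono) auto
  finally have "\<bar>r\<bar> * \<bar>integral {0..1} (\<lambda>s. g (r * s))\<bar> \<le> \<bar>r\<bar> * (C * exp k / k)"
    by (intro mult_left_mono) auto
  also have "\<dots> = C / l * exp k" using False assms by (simp add: k_def)
  finally show ?thesis by (simp add: prim_def abs_mult k_def)
qed (use assms in \<open>auto simp: prim_def\<close>)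

lemma prim_has_real_derivative:
  assumes cont: "continuous_on UNIV g"
  shows "(prim g has_real_derivative g r) (at r)"
proof -
  obtain P where P: "\<And>x. (P has_vector_derivative g x) (at x)"
    using einterval_antiderivative[of "-\<infinity>" "\<infinity>" g] cont
    by (auto simp: continuous_on_eq_continuous_at)
  have "prim g x = P x - P 0" for x
  proof -
    have "((\<lambda>s. x * g (x * s)) has_integral (P (x * 1) - P (x * 0))) {0..1}"
    proof (rule fundamental_theorem_of_calculus)
      fix s :: real
      have "(P has_real_derivative g (x * s)) (at (x * s))"
        using P by (simp add: has_real_derivative_iff_has_vector_derivative)
      from DERIV_chain2[where f = P and g = "\<lambda>s. x * s" and x = s, OF this]
      have "((\<lambda>s. P (x * s)) has_real_derivative g (x * s) * x) (at s)"
        by (auto intro!: derivative_eq_intros)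
      then show "((\<lambda>s. P (x * s)) has_vector_derivative x * g (x * s)) (at s within {0..1})"
        by (simp add: has_real_derivative_iff_has_vector_derivative[symmetric] mult.commute
            has_field_derivative_at_within)
    qed auto
    then show ?thesis by (auto simp: prim_def dest!: integral_unique)
  qed
  then have "prim g = (\<lambda>x. P x - P 0)" by auto
  then show ?thesis
    using P[of r] by (auto simp: has_real_derivative_iff_has_vector_derivative[symmetric] intro!: derivative_eq_intros)
qed

text \<open>
  Here \<open>m = N - 3\<close> and \<open>r = 1 - cos \<theta>\<close>, so \<open>r = 0\<close> is the pole and \<open>r = 1\<close> the equator. The
  integrating factor \<open>(r (2 - r)) powr ((m + 2) / 2)\<close> turns the equation into
  \<open>F' = - A * avg (m + 1) (B * (exp F - 1))\<close>; the substitution \<open>r s\<^sup>2\<close> inside \<open>avg\<close> removes half-integer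
  powers and makes sense on both sides of the pole. The coefficients are frozen outside \<open>[-1, 3/2]\<close>
  and the nonlinearity is truncated at height \<open>a + 1\<close>, which makes the problem globally Lipschitz;
  neither modification is active on the part of the solution that is used, since the energy keeps
  the solution below its initial value \<open>a\<close> on \<open>[0, 1]\<close>.
\<close>

locale shooting =
  fixes m :: nat
  assumes m1: "1 \<le> m" and m7: "m \<le> 7"
begin

definition clamp_r :: "real \<Rightarrow> real" where "clamp_r r = max (-1) (min r (3/2))"
definition A :: "real \<Rightarrow> real" where "A r = (2 - clamp_r r) powr (- (real m + 2) / 2)"
definition B :: "real \<Rightarrow> real" where "B r = 4 * (real m + 1) * (2 - clamp_r r) powr (real m / 2)"
text \<open>Product of upper bounds for \<open>A\<close> and \<open>B\<close>, since
  \<open>2 - clamp_r r\<close> lies between 1/2 and 3.\<close>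

definition K :: real where
  "K = (1/2) powr (- (real m + 2) / 2) * (4 * (real m + 1) * 3 powr (real m / 2))"

lemma K_pos: "0 < K" by (simp add: K_def)
lemma A_pos: "0 < A r" and B_pos: "0 < B r" by (auto simp: A_def B_def clamp_r_def)

lemma A_le: "A r \<le> (1/2) powr (- (real m + 2) / 2)"
  unfolding A_def by (rule powr_mono2') (auto simp: clamp_r_def)

lemma B_le: "B r \<le> 4 * (real m + 1) * 3 powr (real m / 2)"
  unfolding B_def by (intro mult_left_mono powr_mono2) (auto simp: clamp_r_def)

lemma continuous_A [continuous_intros]: "continuous_on S f \<Longrightarrow> continuous_on S (\<lambda>x. A (f x))"
  unfolding A_def clamp_r_def by (intro continuous_intros) auto

lemma continuous_B [continuous_intros]: "continuous_on S f \<Longrightarrow> continuous_on S (\<lambda>x. B (f x))"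
  unfolding B_def clamp_r_def by (intro continuous_intros) auto

definition slope :: "real \<Rightarrow> (real \<Rightarrow> real) \<Rightarrow> real \<Rightarrow> real" where
  "slope a f r = - A r * avg (m + 1) (\<lambda>x. B x * (exp (min (f x) (a + 1)) - 1)) r"

lemma continuous_on_slope:
  assumes "continuous_on UNIV (\<lambda>z::real \<times> real. f (fst z) (snd z))"
  shows "continuous_on UNIV (\<lambda>z. slope (snd z) (\<lambda>x. f x (snd z)) (fst z))"
  unfolding slope_def
  by (intro continuous_intros
      continuous_on_avg[of "\<lambda>x a. B x * (exp (min (f x a) (a + 1)) - 1)"] assms)

lemma continuous_on_slope1:
  assumes "continuous_on UNIV f"
  shows "continuous_on UNIV (slope a f)"
proof -
  have "continuous_on UNIV (\<lambda>z::real\<times>real. f (fst z))"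
    by (intro continuous_on_compose2[OF assms] continuous_intros) auto
  from continuous_on_slice[OF continuous_on_slope[OF this], of a] show ?thesis by simp
qed

lemma slope_bound:
  assumes f: "continuous_on UNIV f" and "0 \<le> C"
    and le: "\<And>s. s \<in> {0..1} \<Longrightarrow> \<bar>exp (min (f (r * s\<^sup>2)) (a + 1)) - 1\<bar> \<le> C"
  shows "\<bar>slope a f r\<bar> \<le> K * C"
proof -
  define b where "b = 4 * (real m + 1) * 3 powr (real m / 2)"
  have "\<bar>avg (m + 1) (\<lambda>x. B x * (exp (min (f x) (a + 1)) - 1)) r\<bar> \<le> b * C"
  proof (rule avg_bound)
    show "continuous_on UNIV (\<lambda>x. B x * (exp (min (f x) (a + 1)) - 1))"
      by (intro continuous_intros f)
    show "0 \<le> b * C" using assms by (simp add: b_def)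
    fix s :: real assume "s \<in> {0..1}"
    then show "\<bar>B (r * s\<^sup>2) * (exp (min (f (r * s\<^sup>2)) (a + 1)) - 1)\<bar> \<le> b * C"
      unfolding abs_mult using B_pos[of "r * s\<^sup>2"] B_le[of "r * s\<^sup>2"] le[of s] \<open>0 \<le> C\<close>
      by (intro mult_mono) (auto simp: b_def)
  qed
  then have "\<bar>slope a f r\<bar> \<le> (1/2) powr (- (real m + 2) / 2) * (b * C)"
    unfolding slope_def abs_mult using A_pos[of r] A_le[of r] assms
    by (intro mult_mono) auto
  then show ?thesis by (simp add: K_def b_def mult.assoc)
qed

lemma exp_min_lipschitz: "\<bar>exp (min x c) - exp (min y c)\<bar> \<le> exp c * \<bar>x - (y::real)\<bar>"
proof -
  have *: "\<bar>exp u - exp v\<bar> \<le> exp c * \<bar>u - v\<bar>" if "u \<le> v" "v \<le> c" for u v :: real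
  proof -
    have "1 + (u - v) \<le> exp (u - v)" by (rule exp_ge_add_one_self)
    then have "exp v * (1 + (u - v)) \<le> exp v * exp (u - v)" by (intro mult_left_mono) auto
    then have "exp v - exp u \<le> exp v * (v - u)" by (simp add: exp_add[symmetric] algebra_simps)
    also have "\<dots> \<le> exp c * (v - u)" using that by (intro mult_right_mono) auto
    finally show ?thesis using that by (simp add: abs_if)
  qed
  have "\<bar>exp (min x c) - exp (min y c)\<bar> \<le> exp c * \<bar>min x c - min y c\<bar>"
    using *[of "min x c" "min y c"] *[of "min y c" "min x c"]
    by (metis abs_minus_commute linear min.cobounded2)
  also have "\<dots> \<le> exp c * \<bar>x - y\<bar>" by (intro mult_left_mono) auto
  finally show ?thesis .
qed

lemma slope_diff_bound:
  assumes f: "continuous_on UNIV f" and g: "continuous_on UNIV g" and "0 \<le> C"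
    and le: "\<And>s. s \<in> {0..1} \<Longrightarrow> \<bar>f (r * s\<^sup>2) - g (r * s\<^sup>2)\<bar> \<le> C"
  shows "\<bar>slope a f r - slope a g r\<bar> \<le> K * (exp (a + 1) * C)"
proof -
  define b where "b = 4 * (real m + 1) * 3 powr (real m / 2)"
  let ?h = "\<lambda>f x. B x * (exp (min (f x) (a + 1)) - 1)"
  have "avg (m + 1) (?h f) r - avg (m + 1) (?h g) r = avg (m + 1) (\<lambda>x. ?h f x - ?h g x) r"
    by (intro avg_diff continuous_intros f g)
  moreover have "\<bar>avg (m + 1) (\<lambda>x. ?h f x - ?h g x) r\<bar> \<le> b * (exp (a + 1) * C)"
  proof (rule avg_bound)
    show "continuous_on UNIV (\<lambda>x. ?h f x - ?h g x)"
      by (intro continuous_intros f g)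
    show "0 \<le> b * (exp (a + 1) * C)" using assms by (simp add: b_def)
    fix s :: real assume s: "s \<in> {0..1}"
    let ?y = "r * s\<^sup>2"
    have "\<bar>exp (min (f ?y) (a + 1)) - exp (min (g ?y) (a + 1))\<bar> \<le> exp (a + 1) * C"
      by (rule order_trans[OF exp_min_lipschitz]) (intro mult_left_mono le s, simp)
    then have "\<bar>B ?y\<bar> * \<bar>exp (min (f ?y) (a + 1)) - exp (min (g ?y) (a + 1))\<bar> \<le> b * (exp (a + 1) * C)"
      using B_pos[of ?y] B_le[of ?y] \<open>0 \<le> C\<close>
      by (intro mult_mono) (auto simp: b_def)
    then show "\<bar>?h f ?y - ?h g ?y\<bar> \<le> b * (exp (a + 1) * C)"
      by (simp add: abs_mult[symmetric] algebra_simps)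
  qed
  ultimately have "\<bar>avg (m + 1) (?h f) r - avg (m + 1) (?h g) r\<bar> \<le> b * (exp (a + 1) * C)" by simp
  then have "\<bar>A r\<bar> * \<bar>avg (m + 1) (?h f) r - avg (m + 1) (?h g) r\<bar>
      \<le> (1/2) powr (- (real m + 2) / 2) * (b * (exp (a + 1) * C))"
    using A_pos[of r] A_le[of r] assms
    by (intro mult_mono) auto
  moreover have "\<bar>slope a f r - slope a g r\<bar> = \<bar>A r\<bar> * \<bar>avg (m + 1) (?h f) r - avg (m + 1) (?h g) r\<bar>"
    unfolding slope_def abs_mult[symmetric] by (simp add: algebra_simps abs_minus_commute)
  ultimately show ?thesis by (simp add: K_def b_def mult.assoc)
qed

text \<open>
  The weight \<open>exp (- rate a * \<bar>r\<bar>)\<close> turns the Picard operator into a contraction uniformly in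
  the initial value \<open>a\<close>, so a single fixed point yields a solution that is jointly continuous in
  \<open>r\<close> and \<open>a\<close>.
\<close>

definition rate :: "real \<Rightarrow> real" where "rate a = 2 * K * (exp (a + 1) + 1)"

lemma rate_pos: "0 < rate a" using K_pos by (simp add: rate_def add_pos_pos)

text \<open>\<open>u\<close> is the deviation of the solution from its initial value divided by the
  weight. Unlike the deviation itself it can be kept bounded on the whole plane, so Banach's theorem
  applies in the space of bounded continuous functions of \<open>(r, a)\<close>.\<close>

definition unweight :: "(real \<times> real \<Rightarrow> real) \<Rightarrow> real \<Rightarrow> real \<Rightarrow> real" where
  "unweight u r a = a + exp (rate a * \<bar>r\<bar>) * u (r, a)"

definition picard :: "(real \<times> real \<Rightarrow> real) \<Rightarrow> real \<times> real \<Rightarrow> real" where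
  "picard u z = exp (- rate (snd z) * \<bar>fst z\<bar>) *
     prim (slope (snd z) (\<lambda>x. unweight u x (snd z))) (fst z)"

lemma continuous_unweight:
  assumes "continuous_on UNIV u"
  shows "continuous_on UNIV (\<lambda>z::real\<times>real. unweight u (fst z) (snd z))"
  unfolding unweight_def rate_def using assms by (auto intro!: continuous_intros)

lemma continuous_picard:
  assumes "continuous_on UNIV u"
  shows "continuous_on UNIV (picard u)"
proof -
  have "continuous_on UNIV (\<lambda>z::real\<times>real.
      prim (\<lambda>y. slope (snd z) (\<lambda>x. unweight u x (snd z)) y) (fst z))"
    by (rule continuous_on_prim[OF continuous_on_slope[OF continuous_unweight[OF assms]]])
  then show ?thesis unfolding picard_def rate_def by (intro continuous_intros)
qed

lemma prim_slope_bound: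
  assumes f: "continuous_on UNIV f"
  shows "\<bar>prim (slope a f) r\<bar> \<le> 1 / 2 * exp (rate a * \<bar>r\<bar>)"
proof -
  have *: "\<bar>slope a f x\<bar> \<le> K * (exp (a + 1) + 1)" for x
  proof (rule slope_bound[OF f])
    fix s :: real
    have "0 < exp (min (f (x * s\<^sup>2)) (a + 1))" "exp (min (f (x * s\<^sup>2)) (a + 1)) \<le> exp (a + 1)" by auto
    then show "\<bar>exp (min (f (x * s\<^sup>2)) (a + 1)) - 1\<bar> \<le> exp (a + 1) + 1" by linarith
  qed (simp add: add_nonneg_nonneg)
  have "\<bar>prim (slope a f) r\<bar> \<le> (K * (exp (a + 1) + 1)) / rate a * exp (rate a * \<bar>r\<bar>)"
  proof (rule prim_bound)
    fix x
    have "K * (exp (a + 1) + 1) * 1 \<le> K * (exp (a + 1) + 1) * exp (rate a * \<bar>x\<bar>)"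
      using rate_pos[of a] K_pos by (intro mult_left_mono) (auto simp: add_nonneg_nonneg)
    with * show "\<bar>slope a f x\<bar> \<le> K * (exp (a + 1) + 1) * exp (rate a * \<bar>x\<bar>)"
      by (metis order_trans mult_1_right)
  qed (use K_pos in \<open>auto intro!: continuous_on_slope1 f rate_pos simp: add_nonneg_nonneg\<close>)
  moreover have "(K * (exp (a + 1) + 1)) / rate a = 1 / 2"
  proof -
    have "rate a = 2 * (K * (exp (a + 1) + 1))" by (simp add: rate_def)
    moreover have "c / (2 * c) = 1 / 2" if "2 * c > 0" for c :: real using that by simp
    ultimately show ?thesis using rate_pos[of a] by metis
  qed
  ultimately show ?thesis by simp
qed

lemma picard_bounded:
  assumes "continuous_on UNIV u"
  shows "\<bar>picard u z\<bar> \<le> 1 / 2"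
proof -
  have "continuous_on UNIV (\<lambda>x. unweight u x (snd z))"
    by (rule continuous_on_slice[OF continuous_unweight[OF assms]])
  from prim_slope_bound[OF this, of "snd z" "fst z"] show ?thesis
    by (simp add: picard_def abs_mult exp_minus divide_simps mult.commute)
qed

text \<open>The average at \<open>x\<close> samples only points \<open>x * s\<^sup>2\<close>, which
  are no farther from 0 than \<open>x\<close>, so the weight at \<open>x\<close> dominates there.
  Integration then divides the Lipschitz constant \<open>K * exp (a + 1)\<close> by
  \<open>rate a\<close>, which is more than twice as large.\<close>

lemma picard_contraction:
  assumes u: "continuous_on UNIV u" and v: "continuous_on UNIV v" and "0 \<le> d"
    and le: "\<And>z. \<bar>u z - v z\<bar> \<le> d"
  shows "\<bar>picard u z - picard v z\<bar> \<le> 1 / 2 * d"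
proof -
  obtain r a where z: "z = (r, a)" by force
  define f where "f x = unweight u x a" for x
  define g where "g x = unweight v x a" for x
  have f: "continuous_on UNIV f" unfolding f_def
    by (rule continuous_on_slice[OF continuous_unweight[OF u]])
  have g: "continuous_on UNIV g" unfolding g_def
    by (rule continuous_on_slice[OF continuous_unweight[OF v]])
  let ?l = "rate a"
  have *: "\<bar>slope a f x - slope a g x\<bar> \<le> (K * exp (a + 1) * d) * exp (?l * \<bar>x\<bar>)" for x
  proof -
    have "\<bar>slope a f x - slope a g x\<bar> \<le> K * (exp (a + 1) * (exp (?l * \<bar>x\<bar>) * d))"
    proof (rule slope_diff_bound[OF f g])
      fix s :: real assume s: "s \<in> {0..1}"
      have "\<bar>x\<bar> * s\<^sup>2 \<le> \<bar>x\<bar> * 1" using s by (intro mult_left_mono) (auto simp: power_le_one)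
      then have "?l * \<bar>x * s\<^sup>2\<bar> \<le> ?l * \<bar>x\<bar>" using rate_pos[of a] by (simp add: abs_mult)
      then have "exp (?l * \<bar>x * s\<^sup>2\<bar>) * \<bar>u (x * s\<^sup>2, a) - v (x * s\<^sup>2, a)\<bar> \<le> exp (?l * \<bar>x\<bar>) * d"
        using le assms(3) by (intro mult_mono) auto
      then show "\<bar>f (x * s\<^sup>2) - g (x * s\<^sup>2)\<bar> \<le> exp (?l * \<bar>x\<bar>) * d"
        unfolding f_def g_def unweight_def by (simp add: abs_mult right_diff_distrib[symmetric])
    qed (use assms in auto)
    then show ?thesis by (simp add: algebra_simps)
  qed
  have "\<bar>prim (slope a f) r - prim (slope a g) r\<bar> \<le> (K * exp (a + 1) * d) / ?l * exp (?l * \<bar>r\<bar>)"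
    unfolding prim_diff[OF continuous_on_slope1[OF f] continuous_on_slope1[OF g]]
    by (rule prim_bound) (use * K_pos assms rate_pos[of a] in \<open>auto intro!: continuous_intros continuous_on_slope1 f g\<close>)
  also have "\<dots> \<le> (1 / 2 * d) * exp (?l * \<bar>r\<bar>)"
  proof (rule mult_right_mono)
    have "K * exp (a + 1) * d \<le> (1/2 * d) * ?l" using K_pos assms by (simp add: rate_def algebra_simps)
    then show "K * exp (a + 1) * d / ?l \<le> 1 / 2 * d"
      using rate_pos[of a] by (simp add: divide_simps)
  qed auto
  finally have "exp (- ?l * \<bar>r\<bar>) * \<bar>prim (slope a f) r - prim (slope a g) r\<bar>
     \<le> exp (- ?l * \<bar>r\<bar>) * ((1 / 2 * d) * exp (?l * \<bar>r\<bar>))" by (intro mult_left_mono) auto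
  also have "\<dots> = 1 / 2 * d" by (simp add: exp_minus)
  also have "exp (- ?l * \<bar>r\<bar>) * \<bar>prim (slope a f) r - prim (slope a g) r\<bar> = \<bar>picard u z - picard v z\<bar>"
    unfolding picard_def f_def[abs_def] g_def[abs_def] z
    by (simp add: right_diff_distrib[symmetric] abs_mult)
  finally show ?thesis .
qed

lemma ex_solution:
  "\<exists>F::real \<Rightarrow> real \<Rightarrow> real. continuous_on UNIV (\<lambda>z. F (fst z) (snd z)) \<and>
     (\<forall>r a. F r a = a + prim (slope a (\<lambda>x. F x a)) r)"
proof -
  define T :: "((real \<times> real) \<Rightarrow>\<^sub>C real) \<Rightarrow> ((real \<times> real) \<Rightarrow>\<^sub>C real)"
    where "T u = Bcontfun (picard (apply_bcontfun u))" for u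
  have cont: "continuous_on UNIV (apply_bcontfun u)" for u :: "(real \<times> real) \<Rightarrow>\<^sub>C real"
    using apply_bcontfun[of u] by (simp add: bcontfun_def)
  have T: "apply_bcontfun (T u) = picard (apply_bcontfun u)" for u
    unfolding T_def
  proof (rule Bcontfun_inverse, rule bcontfun_normI)
    show "continuous_on UNIV (picard (apply_bcontfun u))" by (rule continuous_picard[OF cont])
    show "norm (picard (apply_bcontfun u) x) \<le> 1 / 2" for x
      using picard_bounded[OF cont] by simp
  qed
  have "\<exists>!u. T u = u"
  proof (rule banach_fix_type)
    show "\<forall>u v. dist (T u) (T v) \<le> 1 / 2 * dist u v"
    proof (intro allI dist_bound)
      fix u v z
      show "dist (apply_bcontfun (T u) z) (apply_bcontfun (T v) z) \<le> 1 / 2 * dist u v"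
        unfolding T dist_real_def
        by (rule picard_contraction[OF cont cont]) (use dist_bounded[of u _ v] in \<open>auto simp: dist_real_def\<close>)
    qed
  qed auto
  then obtain u where u: "T u = u" by blast
  define F where "F = unweight (apply_bcontfun u)"
  have "F r a = a + prim (slope a (\<lambda>x. F x a)) r" for r a
  proof -
    have "apply_bcontfun u (r, a) = exp (- rate a * \<bar>r\<bar>) * prim (slope a (\<lambda>x. F x a)) r"
      using fun_cong[OF T[of u], of "(r, a)"] unfolding u by (simp add: picard_def F_def)
    then show ?thesis by (simp add: F_def unweight_def[of _ r a] exp_minus)
  qed
  moreover have "continuous_on UNIV (\<lambda>z. F (fst z) (snd z))"
    unfolding F_def by (rule continuous_unweight[OF cont])
  ultimately show ?thesis by blast
qed

end

section \<open>Smoothness of the solutions\<close>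

lemma DERIV_compose:
  fixes f g :: "real \<Rightarrow> real"
  assumes "(f has_real_derivative D) (at (g x))" "(g has_real_derivative E) (at x)"
  shows "((\<lambda>x. f (g x)) has_real_derivative E * D) (at x)"
  using DERIV_chain2[OF assms] by (simp add: mult.commute)

fun smooth_upto :: "nat \<Rightarrow> (real \<Rightarrow> real) \<Rightarrow> real set \<Rightarrow> bool" where
  "smooth_upto 0 f S \<longleftrightarrow> continuous_on S f"
| "smooth_upto (Suc n) f S \<longleftrightarrow> (\<forall>x\<in>S. f field_differentiable at x) \<and> smooth_upto n (deriv f) S"

lemma smooth_upto_cong:
  assumes "open S" "\<And>x. x \<in> S \<Longrightarrow> f x = g x" "smooth_upto n f S"
  shows "smooth_upto n g S"
  using assms(2,3)
proof (induction n arbitrary: f g)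
  case 0
  then show ?case by (metis continuous_on_cong smooth_upto.simps(1))
next
  case (Suc n)
  have "deriv f x = deriv g x" if "x \<in> S" for x
    using that Suc.prems assms(1) by (intro deriv_cong_ev) (auto simp: eventually_nhds)
  moreover have "g field_differentiable at x" if "x \<in> S" for x
    using that Suc.prems assms(1) unfolding field_differentiable_def smooth_upto.simps
    by (metis has_field_derivative_transform_within_open)
  ultimately show ?case using Suc.IH[of "deriv f" "deriv g"] Suc.prems by auto
qed

lemma smooth_upto_SucI:
  assumes "open S" "\<And>x. x \<in> S \<Longrightarrow> (f has_real_derivative f' x) (at x)" "smooth_upto n f' S"
  shows "smooth_upto (Suc n) f S"
  using assms smooth_upto_cong[of S f' "deriv f" n] DERIV_imp_deriv[OF assms(2)]
  unfolding smooth_upto.simps field_differentiable_def by metis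

lemma smooth_upto_Suc_imp: "smooth_upto (Suc n) f S \<Longrightarrow> smooth_upto n f S"
  by (induction n arbitrary: f)
    (auto intro!: continuous_at_imp_continuous_on field_differentiable_imp_continuous_at)

lemma smooth_upto_Un:
  "open S \<Longrightarrow> open T \<Longrightarrow> smooth_upto n f S \<Longrightarrow> smooth_upto n f T \<Longrightarrow> smooth_upto n f (S \<union> T)"
  by (induction n arbitrary: f) (auto intro: continuous_on_open_Un)

lemma smooth_upto_derivative:
  "smooth_upto (Suc n) f S \<Longrightarrow> x \<in> S \<Longrightarrow> (f has_real_derivative deriv f x) (at x)"
  by (simp add: DERIV_deriv_iff_field_differentiable)

lemma smooth_upto_const: "open S \<Longrightarrow> smooth_upto n (\<lambda>x. c) S"
  by (induction n arbitrary: c) (auto intro!: smooth_upto_SucI[of _ _ "\<lambda>x. 0"] simp del: smooth_upto.simps(2))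

lemma smooth_upto_add:
  "open S \<Longrightarrow> smooth_upto n f S \<Longrightarrow> smooth_upto n g S \<Longrightarrow> smooth_upto n (\<lambda>x. f x + g x) S"
proof (induction n arbitrary: f g)
  case (Suc n)
  show ?case
    by (rule smooth_upto_SucI[where f' = "\<lambda>x. deriv f x + deriv g x"])
      (use Suc in \<open>auto intro!: derivative_eq_intros simp: DERIV_deriv_iff_field_differentiable\<close>)
qed (auto intro: continuous_intros)

lemma smooth_upto_mult:
  "open S \<Longrightarrow> smooth_upto n f S \<Longrightarrow> smooth_upto n g S \<Longrightarrow> smooth_upto n (\<lambda>x. f x * g x) S"
proof (induction n arbitrary: f g)
  case (Suc n)
  have "smooth_upto n f S" "smooth_upto n g S" using Suc.prems smooth_upto_Suc_imp by blast+
  then have "smooth_upto n (\<lambda>x. deriv f x * g x + f x * deriv g x) S"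
    using Suc by (intro smooth_upto_add Suc.IH) auto
  then show ?case
    by (intro smooth_upto_SucI[where f' = "\<lambda>x. deriv f x * g x + f x * deriv g x"])
      (use Suc.prems in \<open>auto intro!: DERIV_cong[OF DERIV_mult] simp: DERIV_deriv_iff_field_differentiable algebra_simps\<close>)
qed (auto intro: continuous_intros)

lemma smooth_upto_exp: "open S \<Longrightarrow> smooth_upto n f S \<Longrightarrow> smooth_upto n (\<lambda>x. exp (f x)) S"
proof (induction n arbitrary: f)
  case (Suc n)
  have "smooth_upto n (\<lambda>x. exp (f x) * deriv f x) S"
    using Suc by (intro smooth_upto_mult Suc.IH smooth_upto_Suc_imp[of n f]) auto
  then show ?case
    by (intro smooth_upto_SucI[where f' = "\<lambda>x. exp (f x) * deriv f x"])
      (use Suc.prems in \<open>auto intro!: derivative_eq_intros simp: DERIV_deriv_iff_field_differentiable\<close>)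
qed (auto intro: continuous_intros)

lemma smooth_upto_powr:
  "open S \<Longrightarrow> S \<subseteq> {..<2} \<Longrightarrow> smooth_upto n (\<lambda>x. (2 - x) powr q) S"
proof (induction n arbitrary: q)
  case 0
  then show ?case by (auto intro!: continuous_intros)
next
  case (Suc n)
  have "smooth_upto n (\<lambda>x. - q * (2 - x) powr (q - 1)) S"
    using Suc by (intro smooth_upto_mult smooth_upto_const) auto
  then show ?case
    by (intro smooth_upto_SucI[where f' = "\<lambda>x. - q * (2 - x) powr (q - 1)"])
      (use Suc.prems in \<open>auto intro!: derivative_eq_intros\<close>)
qed

lemma smooth_upto_affine:
  assumes "open S" "open T"
  shows "smooth_upto n f S \<Longrightarrow> (\<And>x. x \<in> T \<Longrightarrow> b + c * x \<in> S) \<Longrightarrow> smooth_upto n (\<lambda>x. f (b + c * x)) T"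
proof (induction n arbitrary: f)
  case 0
  then show ?case by (auto intro!: continuous_intros continuous_on_compose2[of S f])
next
  case (Suc n)
  have "smooth_upto n (\<lambda>x. c * deriv f (b + c * x)) T"
    using Suc assms by (intro smooth_upto_mult smooth_upto_const) auto
  then show ?case
  proof (rule smooth_upto_SucI[OF assms(2), rotated])
    fix x assume "x \<in> T"
    then have "(f has_real_derivative deriv f (b + c * x)) (at (b + c * x))"
      using Suc.prems by (simp add: DERIV_deriv_iff_field_differentiable)
    moreover have "((\<lambda>x. b + c * x) has_real_derivative c) (at x)"
      by (auto intro!: derivative_eq_intros)
    ultimately show "((\<lambda>x. f (b + c * x)) has_real_derivative c * deriv f (b + c * x)) (at x)"
      by (rule DERIV_compose[where f = f and g = "\<lambda>x. b + c * x" and x = x])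
  qed
qed

section \<open>Regularity of averages along segments issuing from 0\<close>

lemma mult_mem_convex:
  fixes x s :: real
  assumes "convex J" "0 \<in> J" "x \<in> J" "s \<in> {0..1}"
  shows "x * s \<in> J"
  using convexD_alt[of J 0 x s] assms by (simp add: mult.commute)

lemma mult_square_mem_convex:
  fixes x s :: real
  assumes "convex J" "0 \<in> J" "x \<in> J" "s \<in> {0..1}"
  shows "x * s\<^sup>2 \<in> J"
  using mult_mem_convex[of J x "s\<^sup>2"] assms by (auto simp: power_le_one)

lemma continuous_on_avg_local:
  assumes "convex J" "0 \<in> J" "continuous_on J g"
  shows "continuous_on J (avg p g)"
proof -
  have "continuous_on (J \<times> cbox 0 1) (\<lambda>(x, s). s ^ p * g (x * s\<^sup>2))"
    unfolding case_prod_unfold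
    by (intro continuous_intros continuous_on_compose2[OF assms(3)])
      (auto intro: mult_square_mem_convex assms)
  from integral_continuous_on_param[OF this] show ?thesis
    by (simp add: avg_def[abs_def])
qed

text \<open>Differentiation under the integral produces a factor \<open>s\<^sup>2\<close>, which
  only raises the exponent. The averages are thus closed under differentiation, and smoothness
  follows by induction with \<open>p\<close> arbitrary.\<close>

lemma avg_has_real_derivative:
  assumes J: "open J" "convex J" "0 \<in> J" and "x \<in> J"
    and g: "\<And>x. x \<in> J \<Longrightarrow> (g has_real_derivative g' x) (at x)" and cont: "continuous_on J g'"
  shows "(avg p g has_real_derivative avg (p + 2) g' x) (at x)"
proof -
  have contg: "continuous_on J g"
    using g by (meson DERIV_continuous continuous_at_imp_continuous_on)
  have "((\<lambda>x. integral (cbox 0 1) (\<lambda>s. s ^ p * g (x * s\<^sup>2))) has_real_derivative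
      integral (cbox 0 1) (\<lambda>s. s ^ (p + 2) * g' (x * s\<^sup>2))) (at x within J)"
  proof (rule leibniz_rule_field_derivative[OF _ _ _ \<open>x \<in> J\<close> \<open>convex J\<close>])
    fix x s :: real assume x: "x \<in> J" and s: "s \<in> cbox 0 1"
    have "(g has_real_derivative g' (x * s\<^sup>2)) (at (x * s\<^sup>2))"
      using x s by (intro g mult_square_mem_convex J) auto
    moreover have "((\<lambda>x. x * s\<^sup>2) has_real_derivative s\<^sup>2) (at x)"
      by (auto intro!: derivative_eq_intros)
    ultimately have "((\<lambda>x. g (x * s\<^sup>2)) has_real_derivative s\<^sup>2 * g' (x * s\<^sup>2)) (at x)"
      by (rule DERIV_compose[where f = g and g = "\<lambda>x. x * s\<^sup>2" and x = x])
    then have "((\<lambda>x. s ^ p * g (x * s\<^sup>2)) has_real_derivative s ^ (p + 2) * g' (x * s\<^sup>2)) (at x)"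
      by (rule DERIV_cong[OF DERIV_cmult]) (simp add: power_add power2_eq_square)
    then show "((\<lambda>x. s ^ p * g (x * s\<^sup>2)) has_real_derivative s ^ (p + 2) * g' (x * s\<^sup>2)) (at x within J)"
      by (rule has_field_derivative_at_within)
  next
    fix x :: real assume x: "x \<in> J"
    show "(\<lambda>s. s ^ p * g (x * s\<^sup>2)) integrable_on cbox 0 1"
      by (intro integrable_continuous continuous_intros continuous_on_compose2[OF contg])
        (auto intro: mult_square_mem_convex J x)
  next
    show "continuous_on (J \<times> cbox 0 1) (\<lambda>(x, s). s ^ (p + 2) * g' (x * s\<^sup>2))"
      unfolding case_prod_unfold
      by (intro continuous_intros continuous_on_compose2[OF cont])
        (auto intro: mult_square_mem_convex J)
  qed
  then show ?thesis using at_within_open[OF \<open>x \<in> J\<close> \<open>open J\<close>] by (simp add: avg_def[abs_def])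
qed

lemma smooth_upto_avg:
  assumes J: "open J" "convex J" "0 \<in> J"
  shows "smooth_upto n g J \<Longrightarrow> smooth_upto n (avg p g) J"
proof (induction n arbitrary: g p)
  case 0
  then show ?case using continuous_on_avg_local J by simp
next
  case (Suc n)
  have cont: "continuous_on J (deriv g)"
    using Suc.prems by (cases n) (auto intro!: continuous_at_imp_continuous_on field_differentiable_imp_continuous_at)
  show ?case
  proof (rule smooth_upto_SucI[OF J(1)])
    show "(avg p g has_real_derivative avg (p + 2) (deriv g) x) (at x)" if "x \<in> J" for x
      by (rule avg_has_real_derivative[OF J that _ cont])
        (use Suc.prems in \<open>simp add: DERIV_deriv_iff_field_differentiable\<close>)
    show "smooth_upto n (avg (p + 2) (deriv g)) J" using Suc by auto
  qed
qed

text \<open>Integrate the derivative of \<open>s ^ (p + 1) * g (x * s\<^sup>2)\<close> over the unit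
  interval. For \<open>p = m + 1\<close> this recovers the differential equation from the integral
  one without a division by \<open>x\<close>, hence also at the pole.\<close>

lemma avg_euler:
  assumes J: "open J" "convex J" "0 \<in> J" and "x \<in> J"
    and g: "\<And>x. x \<in> J \<Longrightarrow> (g has_real_derivative g' x) (at x)" and cont: "continuous_on J g'"
  shows "2 * x * avg (p + 2) g' x + (real p + 1) * avg p g x = g x"
proof -
  have contg: "continuous_on J g"
    using g by (meson DERIV_continuous continuous_at_imp_continuous_on)
  have I: "((\<lambda>s. (real p + 1) * (s ^ p * g (x * s\<^sup>2)) + 2 * x * (s ^ (p + 2) * g' (x * s\<^sup>2)))
     has_integral (1 ^ (p + 1) * g (x * 1\<^sup>2) - 0 ^ (p + 1) * g (x * 0\<^sup>2))) {0..1}"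
  proof (rule fundamental_theorem_of_calculus)
    fix s :: real assume s: "s \<in> {0..1}"
    have "(g has_real_derivative g' (x * s\<^sup>2)) (at (x * s\<^sup>2))"
      using s by (intro g mult_square_mem_convex assms)
    moreover have "((\<lambda>s. x * s\<^sup>2) has_real_derivative 2 * x * s) (at s)"
      by (auto intro!: derivative_eq_intros)
    ultimately have "((\<lambda>s. g (x * s\<^sup>2)) has_real_derivative (2 * x * s) * g' (x * s\<^sup>2)) (at s)"
      by (rule DERIV_compose[where f = g and g = "\<lambda>s. x * s\<^sup>2" and x = s])
    from DERIV_mult[OF DERIV_pow[of "p + 1" s] this]
    have "((\<lambda>s. s ^ (p + 1) * g (x * s\<^sup>2)) has_real_derivative
      (real p + 1) * (s ^ p * g (x * s\<^sup>2)) + 2 * x * (s ^ (p + 2) * g' (x * s\<^sup>2))) (at s)"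
      by (rule DERIV_cong) (simp add: algebra_simps power2_eq_square)
    then show "((\<lambda>s. s ^ (p + 1) * g (x * s\<^sup>2)) has_vector_derivative
      (real p + 1) * (s ^ p * g (x * s\<^sup>2)) + 2 * x * (s ^ (p + 2) * g' (x * s\<^sup>2))) (at s within {0..1})"
      by (simp add: has_real_derivative_iff_has_vector_derivative[symmetric] has_field_derivative_at_within)
  qed auto
  have i1: "(\<lambda>s. s ^ p * g (x * s\<^sup>2)) integrable_on {0..1}"
    by (intro integrable_continuous_interval continuous_intros continuous_on_compose2[OF contg])
        (auto intro: mult_square_mem_convex assms)
  have i2: "(\<lambda>s. s ^ (p + 2) * g' (x * s\<^sup>2)) integrable_on {0..1}"
    by (intro integrable_continuous_interval continuous_intros continuous_on_compose2[OF cont])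
        (auto intro: mult_square_mem_convex assms)
  have "((\<lambda>s. (real p + 1) * (s ^ p * g (x * s\<^sup>2)) + 2 * x * (s ^ (p + 2) * g' (x * s\<^sup>2)))
     has_integral ((real p + 1) * avg p g x + 2 * x * avg (p + 2) g' x)) {0..1}"
    unfolding avg_def by (intro has_integral_add has_integral_mult_right integrable_integral i1 i2)
  from has_integral_unique[OF this I] show ?thesis by simp
qed

section \<open>Smoothness of the shooting solutions and their differential equation\<close>

context shooting
begin

definition sol :: "real \<Rightarrow> real \<Rightarrow> real" where
  "sol = (SOME F. continuous_on UNIV (\<lambda>z. F (fst z) (snd z)) \<and>
     (\<forall>r a. F r a = a + prim (slope a (\<lambda>x. F x a)) r))"

definition dsol :: "real \<Rightarrow> real \<Rightarrow> real" where
  "dsol r a = slope a (\<lambda>x. sol x a) r"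

lemma sol_props:
  "continuous_on UNIV (\<lambda>z. sol (fst z) (snd z)) \<and> (\<forall>r a. sol r a = a + prim (slope a (\<lambda>x. sol x a)) r)"
  unfolding sol_def by (rule someI_ex[OF ex_solution])

lemmas continuous_sol = sol_props[THEN conjunct1]
  and sol_eq = sol_props[THEN conjunct2, rule_format]

lemma continuous_on_sol [continuous_intros]:
  "continuous_on S p \<Longrightarrow> continuous_on S q \<Longrightarrow> continuous_on S (\<lambda>x. sol (p x) (q x))"
  by (rule continuous_on_binary[OF continuous_sol])

lemma continuous_on_dsol [continuous_intros]:
  "continuous_on S p \<Longrightarrow> continuous_on S q \<Longrightarrow> continuous_on S (\<lambda>x. dsol (p x) (q x))"
  unfolding dsol_def by (rule continuous_on_binary[OF continuous_on_slope[OF continuous_sol]])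

lemma sol_0: "sol 0 a = a"
  by (subst sol_eq) (simp add: prim_def)

lemma sol_has_derivative: "((\<lambda>x. sol x a) has_real_derivative dsol r a) (at r)"
proof -
  have "continuous_on UNIV (slope a (\<lambda>x. sol x a))"
    by (intro continuous_on_slope1 continuous_intros)
  then have "((\<lambda>r. a + prim (slope a (\<lambda>x. sol x a)) r) has_real_derivative 0 + dsol r a) (at r)"
    unfolding dsol_def by (intro DERIV_add DERIV_const prim_has_real_derivative)
  moreover have "(\<lambda>r. sol r a) = (\<lambda>r. a + prim (slope a (\<lambda>x. sol x a)) r)" using sol_eq by (rule ext)
  ultimately show ?thesis by simp
qed

text \<open>On \<open>J\<close> neither the clamping nor the truncation acts. If \<open>sol\<close>
  is of class \<open>n\<close>, then so is its derivative \<open>dsol\<close>, being an average of a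
  smooth function of \<open>sol\<close> times a power; so \<open>sol\<close> is of class
  \<open>n + 1\<close>. The equation comes from differentiating the integral formula and applying
  \<open>avg_euler\<close>. \<open>J\<close> is convex around 0 because averages at \<open>r\<close>
  look at the whole segment from 0 to \<open>r\<close>.\<close>

lemma sol_smooth_and_ode:
  assumes J: "open J" "convex J" "0 \<in> J" "J \<subseteq> {-1<..<3/2}"
    and below: "\<And>x. x \<in> J \<Longrightarrow> sol x a < a + 1"
  shows "smooth_upto n (\<lambda>x. sol x a) J"
    and "r \<in> J \<Longrightarrow> ((\<lambda>x. dsol x a) has_real_derivative deriv (\<lambda>x. dsol x a) r) (at r)"
    and "r \<in> J \<Longrightarrow> r * (2 - r) * deriv (\<lambda>x. dsol x a) r + (real m + 2) * (1 - r) * dsol r a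
           + 2 * (real m + 1) * (exp (sol r a) - 1) = 0"
proof -
  define g where "g x = B x * (exp (min (sol x a) (a + 1)) - 1)" for x
  define h where "h x = 4 * (real m + 1) * ((2 - x) powr (real m / 2) * (exp (sol x a) + (- 1)))" for x
  define I where "I = avg (m + 1) g"
  define q where "q = (real m + 2) / 2"
  have q: "- (real m + 2) / 2 = - q" by (simp only: q_def minus_divide_left)
  have gh: "g x = h x" if "x \<in> J" for x
    using that below[OF that] J(4) by (auto simp: g_def h_def B_def clamp_r_def min_def max_def)
  have dsol: "dsol x a = (- 1) * ((2 - x) powr (- q) * I x)" if "x \<in> J" for x
  proof -
    have "clamp_r x = x" using that J(4) by (force simp: clamp_r_def)
    then show ?thesis unfolding dsol_def slope_def A_def q I_def g_def[abs_def] by (simp only: mult_minus1 mult_minus_left)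
  qed
  have step: "smooth_upto n g J" "smooth_upto n (\<lambda>x. dsol x a) J" if "smooth_upto n (\<lambda>x. sol x a) J" for n
  proof -
    have "smooth_upto n h J" unfolding h_def
      using J(4) by (intro smooth_upto_mult smooth_upto_const smooth_upto_add smooth_upto_powr smooth_upto_exp J that) auto
    then show g: "smooth_upto n g J"
      by (rule smooth_upto_cong[OF J(1), rotated]) (simp add: gh)
    have "smooth_upto n (\<lambda>x. (- 1) * ((2 - x) powr (- q) * I x)) J"
      unfolding I_def using J(4) by (intro smooth_upto_mult smooth_upto_const smooth_upto_avg g smooth_upto_powr J) auto
    then show "smooth_upto n (\<lambda>x. dsol x a) J"
      by (rule smooth_upto_cong[OF J(1), rotated]) (rule dsol[symmetric])
  qed
  have smooth: "smooth_upto n (\<lambda>x. sol x a) J" for n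
  proof (induction n)
    case 0
    then show ?case by (auto intro!: continuous_intros)
  next
    case (Suc n)
    then show ?case by (intro smooth_upto_SucI[OF J(1) sol_has_derivative] step)
  qed
  then show "smooth_upto n (\<lambda>x. sol x a) J" .
  assume r: "r \<in> J"
  show d: "((\<lambda>x. dsol x a) has_real_derivative deriv (\<lambda>x. dsol x a) r) (at r)"
    by (rule smooth_upto_derivative[OF step(2)[OF smooth, of "Suc 0"] r])
  have g': "(g has_real_derivative deriv g x) (at x)" if "x \<in> J" for x
    by (rule smooth_upto_derivative[OF step(1)[OF smooth, of "Suc 0"] that])
  have cont: "continuous_on J (deriv g)" using step(1)[OF smooth, of "Suc 0"] by simp
  define I' where "I' = avg (m + 1 + 2) (deriv g) r"
  define P where "P = (2 - r) powr (- q)"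
  have r2: "r < 2" using r J(4) by auto
  have I': "(I has_real_derivative I') (at r)" unfolding I_def I'_def
    by (rule avg_has_real_derivative[OF J(1-3) r g' cont])
  have "((\<lambda>x. (2 - x) powr (- q)) has_real_derivative (- 1) * (- q * (2 - r) powr (- q - 1))) (at r)"
    by (rule DERIV_compose[OF has_real_derivative_powr]) (use r2 in \<open>auto intro!: derivative_eq_intros\<close>)
  from DERIV_cmult[OF DERIV_mult[OF this I'], of "- 1"]
  have "((\<lambda>x. (- 1) * ((2 - x) powr (- q) * I x)) has_real_derivative
      - (q * (2 - r) powr (- q - 1) * I r + P * I')) (at r)"
    by (rule DERIV_cong) (simp add: P_def)
  then have "((\<lambda>x. dsol x a) has_real_derivative - (q * (2 - r) powr (- q - 1) * I r + P * I')) (at r)"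
    by (rule has_field_derivative_transform_within_open[OF _ J(1) r]) (rule dsol[symmetric])
  then have D: "deriv (\<lambda>x. dsol x a) r = - (q * (2 - r) powr (- q - 1) * I r + P * I')"
    by (rule DERIV_imp_deriv)
  have E: "2 * r * I' = g r - (real m + 2) * I r"
    using avg_euler[OF J(1-3) r g' cont, of "m + 1"] by (simp add: I_def I'_def algebra_simps)
  have P1: "(2 - r) * (2 - r) powr (- q - 1) = P"
    using r2 powr_mult_base[of "2 - r" "- q - 1"] unfolding P_def by auto
  have Pg: "(2 - r) * P * g r = 4 * (real m + 1) * (exp (sol r a) - 1)"
  proof -
    \<comment> \<open>The exponents \<open>1\<close>, \<open>- (m + 2) / 2\<close> and
      \<open>m / 2\<close> add up to zero, so the powers in \<open>A\<close> and \<open>B\<close>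
      cancel against the leading coefficient.\<close>
    have "(2 - r) powr 1 * (2 - r) powr (- q) * (2 - r) powr (real m / 2) = (2 - r) powr (1 + - q + real m / 2)"
      unfolding powr_add ..
    also have "1 + - q + real m / 2 = 0" unfolding q_def by (simp add: add_divide_distrib)
    finally have "(2 - r) * P * (2 - r) powr (real m / 2) = 1" using r2 by (simp add: P_def)
    moreover have "(2 - r) * P * g r = ((2 - r) * P * (2 - r) powr (real m / 2))
        * (4 * (real m + 1) * (exp (sol r a) - 1))"
      unfolding gh[OF r] h_def by (simp only: ac_simps diff_conv_add_uminus)
    ultimately show ?thesis by simp
  qed
  have ds: "dsol r a = - (P * I r)" using dsol[OF r] by (simp add: P_def)
  have m2: "real m + 2 = 2 * q" by (simp add: q_def)
  define X where "X = P * I r"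
  define Y where "Y = 2 * (real m + 1) * (exp (sol r a) - 1)"
  have f1: "(2 - r) * P * (2 * r * I') = 2 * Y - (2 - r) * (2 * q) * X"
    unfolding E right_diff_distrib Pg m2 X_def Y_def by (simp only: ac_simps)
  have "2 * (r * (2 - r) * deriv (\<lambda>x. dsol x a) r)
      = - 2 * (q * r * ((2 - r) * (2 - r) powr (- q - 1)) * I r) - (2 - r) * P * (2 * r * I')"
    unfolding D by (simp add: algebra_simps)
  also have "\<dots> = 2 * ((2 - r) * q * X - q * r * X - Y)"
    unfolding P1 f1 X_def by (simp add: algebra_simps)
  finally have "r * (2 - r) * deriv (\<lambda>x. dsol x a) r = (2 - r) * q * X - q * r * X - Y" by simp
  then show "r * (2 - r) * deriv (\<lambda>x. dsol x a) r + (real m + 2) * (1 - r) * dsol r a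
           + 2 * (real m + 1) * (exp (sol r a) - 1) = 0"
    unfolding ds m2 X_def[symmetric] Y_def[symmetric] by (simp only:) (simp add: algebra_simps)
qed

end

section \<open>Rotation of damped orbits\<close>

lemma exp_minus_one_ge: "w \<le> exp w - (1::real)"
  using exp_ge_add_one_self[of w] by linarith

text \<open>The force \<open>exp w - 1\<close> saturates at -1 for very negative \<open>w\<close>,
  so no multiple of \<open>w\<^sup>2\<close> is a lower bound on the whole line; the denominator
  accounts for this.\<close>

lemma exp_diff_mult_ge: "w\<^sup>2 / (1 + \<bar>w\<bar>) \<le> w * (exp w - (1::real))"
proof (cases "w \<ge> 0")
  case True
  then have "w * w \<le> w * (exp w - 1)" using exp_minus_one_ge[of w] by (intro mult_left_mono) auto
  moreover have "w\<^sup>2 / (1 + \<bar>w\<bar>) \<le> w\<^sup>2" using True by (intro mult_imp_div_pos_le) (auto simp: mult_le_cancel_left1)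
  ultimately show ?thesis by (simp add: power2_eq_square)
next
  case False
  have "exp w * (1 - w) \<le> exp w * exp (- w)" using exp_ge_add_one_self[of "- w"] by (intro mult_left_mono) auto
  then have "exp w * (1 - w) \<le> 1" by (simp add: exp_minus)
  then have "exp w \<le> 1 / (1 - w)" using False by (simp add: pos_le_divide_eq)
  moreover have "1 / (1 - w) - 1 = w / (1 - w)" using False by (simp add: field_simps)
  ultimately have "exp w - 1 \<le> w / (1 - w)" by linarith
  then have "w * (w / (1 - w)) \<le> w * (exp w - 1)" using False by (intro mult_left_mono_neg) auto
  then show ?thesis using False by (simp add: power2_eq_square)
qed

lemma exp_diff_mult_nonneg: "0 \<le> w * (exp w - (1::real))"
  by (rule order_trans[OF _ exp_diff_mult_ge]) simp

lemma exp_excess_le: "exp w - 1 - w \<le> w * (exp w - (1::real))"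
proof -
  have "exp w * (1 - w) \<le> exp w * exp (- w)" using exp_ge_add_one_self[of "- w"] by (intro mult_left_mono) auto
  then show ?thesis by (simp add: exp_minus algebra_simps)
qed

text \<open>By convexity the graph of the excess lies above its tangent at \<open>- y\<close>, whose
  slope \<open>exp (- y) - 1\<close> is at most 0.\<close>

lemma exp_excess_ge:
  assumes "w \<le> - y" "0 \<le> (y::real)"
  shows "exp (- y) - 1 + y \<le> exp w - 1 - w"
proof -
  have "exp (- y) * (1 + (w + y)) \<le> exp (- y) * exp (w + y)" by (intro mult_left_mono exp_ge_add_one_self) auto
  then have "exp (- y) * (1 + (w + y)) \<le> exp w" by (simp add: exp_add[symmetric])
  moreover have "0 \<le> (w + y) * (exp (- y) - 1)" using assms by (intro mult_nonpos_nonpos) auto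
  ultimately show ?thesis by (simp add: algebra_simps)
qed

lemma tanh_le_minus_half: "t \<le> -1 \<Longrightarrow> tanh t \<le> - (1/2 :: real)"
proof -
  assume t: "t \<le> -1"
  have "1 + (- (2 * t)) \<le> exp (- (2 * t))" by (rule exp_ge_add_one_self)
  then have "3 \<le> exp (- (2 * t))" using t by linarith
  then show ?thesis unfolding tanh_real_altdef by (simp add: field_simps)
qed

text \<open>
  The origin is a focus of the limiting autonomous equation as \<open>t \<rightarrow> -\<infinity>\<close> exactly when
  \<open>m < 8\<close>; this is where the upper bound on the dimension enters.
\<close>

locale damped_orbit =
  fixes m b \<tau> :: real and w v :: "real \<Rightarrow> real"
  assumes m1: "1 \<le> m" and m7: "m \<le> 7" and b0: "0 \<le> b" and \<tau>0: "\<tau> \<le> 0"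
    and dw: "\<And>t. t \<in> {\<tau>..0} \<Longrightarrow> (w has_real_derivative v t) (at t)"
    and dv: "\<And>t. t \<in> {\<tau>..0} \<Longrightarrow>
      (v has_real_derivative m * tanh t * v t - 2 * m * (exp (w t) - 1)) (at t)"
    and w_init: "- b \<le> w \<tau>" "w \<tau> < 0"
    and v_init: "1/2 \<le> v \<tau>" "v \<tau> \<le> 5/2"
begin

definition energy :: "real \<Rightarrow> real" where
  "energy t = (v t)\<^sup>2 / 2 + 2 * m * (exp (w t) - 1 - w t)"

lemma energy_nonneg: "0 \<le> energy t" and v2_le: "(v t)\<^sup>2 \<le> 2 * energy t"
  and excess_le: "2 * m * (exp (w t) - 1 - w t) \<le> energy t"
proof -
  have "0 \<le> 2 * m * (exp (w t) - 1 - w t)"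
    using exp_minus_one_ge[of "w t"] m1 by (intro mult_nonneg_nonneg) auto
  then show "0 \<le> energy t" "(v t)\<^sup>2 \<le> 2 * energy t" "2 * m * (exp (w t) - 1 - w t) \<le> energy t"
    by (auto simp: energy_def)
qed

lemma energy_le_quad: "energy t \<le> (v t)\<^sup>2 / 2 + 2 * m * (w t * (exp (w t) - 1))"
  unfolding energy_def using exp_excess_le[of "w t"] m1 by (intro add_left_mono mult_left_mono) auto

lemma energy_deriv:
  assumes "t \<in> {\<tau>..0}"
  shows "(energy has_real_derivative m * tanh t * (v t)\<^sup>2) (at t)"
  unfolding energy_def
  by (auto intro!: derivative_eq_intros dw[OF assms] dv[OF assms] simp: field_simps power2_eq_square)

lemma energy_antimono: "\<tau> \<le> s \<Longrightarrow> s \<le> t \<Longrightarrow> t \<le> 0 \<Longrightarrow> energy t \<le> energy s"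
proof (rule DERIV_nonpos_imp_nonincreasing[where f = energy])
  fix x assume x: "\<tau> \<le> s" "s \<le> t" "t \<le> 0" "s \<le> x" "x \<le> t"
  have "m * tanh x * (v x)\<^sup>2 \<le> 0" using x m1
    by (intro mult_nonpos_nonneg mult_nonneg_nonpos) (auto simp: tanh_real_nonpos_iff)
  then show "\<exists>y. (energy has_real_derivative y) (at x) \<and> y \<le> 0"
    using energy_deriv[of x] x by auto
qed

text \<open>The friction coefficient is at least \<open>- m\<close>, hence the energy decays no
  faster than \<open>exp (- 2 * m * t)\<close>. So the orbit never reaches the origin, and its polar
  angle makes sense on the whole interval.\<close>

lemma energy_pos:
  assumes "t \<in> {\<tau>..0}"
  shows "0 < energy t"
proof -
  have "energy \<tau> * exp (2 * m * \<tau>) \<le> energy t * exp (2 * m * t)"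
  proof (rule DERIV_nonneg_imp_nondecreasing[where f = "\<lambda>t. energy t * exp (2 * m * t)"])
    fix x assume x: "\<tau> \<le> x" "x \<le> t"
    then have x': "x \<in> {\<tau>..0}" using assms by auto
    have "((\<lambda>t. energy t * exp (2 * m * t)) has_real_derivative
       (m * (1 + tanh x) * (v x)\<^sup>2 + m * (2 * energy x - (v x)\<^sup>2)) * exp (2 * m * x)) (at x)"
      by (rule derivative_eq_intros energy_deriv[OF x'] refl)+ (simp add: algebra_simps)
    moreover have "0 \<le> (m * (1 + tanh x) * (v x)\<^sup>2 + m * (2 * energy x - (v x)\<^sup>2)) * exp (2 * m * x)"
    proof -
      have "0 \<le> 1 + tanh x" using tanh_real_gt_neg1[of x] by simp
      then show ?thesis using m1 v2_le[of x] by (intro mult_nonneg_nonneg add_nonneg_nonneg[of "m * (1 + tanh x) * (v x)\<^sup>2"]) auto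
    qed
    ultimately show "\<exists>y. ((\<lambda>t. energy t * exp (2 * m * t)) has_real_derivative y) (at x) \<and> 0 \<le> y" by blast
  qed (use assms in auto)
  moreover have "0 < energy \<tau>"
  proof -
    have "0 < (v \<tau>)\<^sup>2" using v_init by simp
    then show ?thesis using v2_le[of \<tau>] by linarith
  qed
  ultimately have "0 < energy t * exp (2 * m * t)"
    by (smt (verit) exp_gt_zero mult_pos_pos)
  then show ?thesis by (simp add: zero_less_mult_iff)
qed

lemma nonzero: "t \<in> {\<tau>..0} \<Longrightarrow> 0 < (w t)\<^sup>2 + (v t)\<^sup>2"
  using energy_pos[of t] by (auto simp: energy_def sum_power2_gt_zero_iff)

text \<open>Angular velocity of the point \<open>(w, v)\<close>, with \<open>w' = v\<close> and the
  equation for \<open>v'\<close> inserted.\<close>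

definition rotation :: "real \<Rightarrow> real" where
  "rotation t = (w t * (m * tanh t * v t - 2 * m * (exp (w t) - 1)) - (v t)\<^sup>2) / ((w t)\<^sup>2 + (v t)\<^sup>2)"

text \<open>A polar angle of the starting point, which lies in the second quadrant since
  \<open>w < 0 < v\<close> there.\<close>

definition angle0 :: real where "angle0 = pi / 2 + arctan (- w \<tau> / v \<tau>)"

lemma continuous_rotation: "continuous_on {\<tau>..0} rotation"
proof -
  have "continuous_on {\<tau>..0} w" "continuous_on {\<tau>..0} v"
    using dw dv by (meson DERIV_continuous continuous_at_imp_continuous_on)+
  moreover have "\<forall>t\<in>{\<tau>..0}. (w t)\<^sup>2 + (v t)\<^sup>2 \<noteq> 0" using nonzero by (metis less_irrefl)
  ultimately show ?thesis unfolding rotation_def by (intro continuous_intros) auto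
qed

lemma integrable_rotation: "\<tau> \<le> s \<Longrightarrow> t \<le> 0 \<Longrightarrow> rotation integrable_on {s..t}"
  by (intro integrable_continuous_interval continuous_on_subset[OF continuous_rotation]) auto

text \<open>
  With \<open>z = w + i v\<close> and \<open>\<theta>\<close> the angle below, \<open>z exp (- i \<theta>) / \<bar>z\<bar>\<close> has derivative zero; the
  argument is carried out for the square of its imaginary part.
\<close>

lemma angle_end:
  defines "\<theta> \<equiv> angle0 + integral {\<tau>..0} rotation"
  shows "w 0 * sin \<theta> = v 0 * cos \<theta>"
proof -
  define \<phi> where "\<phi> t = angle0 + integral {\<tau>..t} rotation" for t
  define q where "q t = w t * sin (\<phi> t) - v t * cos (\<phi> t)" for t
  define f where "f t = (q t)\<^sup>2 / ((w t)\<^sup>2 + (v t)\<^sup>2)" for t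
  have "(f has_real_derivative 0) (at t within {\<tau>..0})" if t: "t \<in> {\<tau>..0}" for t
  proof -
    define v' where "v' = m * tanh t * v t - 2 * m * (exp (w t) - 1)"
    have d\<phi>: "(\<phi> has_real_derivative rotation t) (at t within {\<tau>..0})"
      unfolding \<phi>_def using integral_has_real_derivative[OF continuous_rotation t]
      by (auto intro!: derivative_eq_intros)
    have dw': "(w has_real_derivative v t) (at t within {\<tau>..0})"
      using dw[OF t] by (rule has_field_derivative_at_within)
    have dv': "(v has_real_derivative v') (at t within {\<tau>..0})"
      using dv[OF t] unfolding v'_def by (rule has_field_derivative_at_within)
    let ?n = "(w t)\<^sup>2 + (v t)\<^sup>2"
    have n: "?n \<noteq> 0" using nonzero[OF t] by (metis less_irrefl)
    define u where "u = w t * cos (\<phi> t) + v t * sin (\<phi> t)"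
    define q' where "q' = v t * sin (\<phi> t) - v' * cos (\<phi> t) + rotation t * u"
    have dq: "(q has_real_derivative q') (at t within {\<tau>..0})"
      unfolding q_def
      by (rule derivative_eq_intros dw' dv' d\<phi> refl)+ (simp add: q'_def u_def algebra_simps)
    have rot: "?n * rotation t = w t * v' - (v t)\<^sup>2"
      using n by (simp add: rotation_def v'_def)
    have "?n * q' = (w t * v t + v t * v') * q t"
    proof -
      have "?n * q' = ?n * (v t * sin (\<phi> t) - v' * cos (\<phi> t)) + (?n * rotation t) * u"
        by (simp add: q'_def algebra_simps)
      then show ?thesis unfolding rot by (simp add: q_def u_def algebra_simps power2_eq_square)
    qed
    then have "2 * q t * (?n * q') = 2 * q t * ((w t * v t + v t * v') * q t)" by (rule arg_cong)
    then have *: "2 * q t * q' * ?n = (q t)\<^sup>2 * (2 * w t * v t + 2 * v t * v')"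
      by (simp only: power2_eq_square distrib_left distrib_right ac_simps)
    have "((\<lambda>t. (w t)\<^sup>2 + (v t)\<^sup>2) has_real_derivative (2 * w t * v t + 2 * v t * v')) (at t within {\<tau>..0})"
      by (rule derivative_eq_intros dw' dv' refl)+ simp
    moreover have "((\<lambda>t. (q t)\<^sup>2) has_real_derivative 2 * q t * q') (at t within {\<tau>..0})"
      by (rule derivative_eq_intros dq refl)+ simp
    ultimately show ?thesis unfolding f_def
      using n * by (auto intro!: DERIV_cong[OF DERIV_divide])
  qed
  then obtain c where c: "\<And>t. t \<in> {\<tau>..0} \<Longrightarrow> f t = c"
    using has_field_derivative_zero_constant[of "{\<tau>..0}" f] by auto
  have "q \<tau> = 0"
  proof -
    define \<beta> where "\<beta> = arctan (- w \<tau> / v \<tau>)"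
    have "cos \<beta> \<noteq> 0" unfolding \<beta>_def using cos_arctan_not_zero .
    have "tan \<beta> = - w \<tau> / v \<tau>" by (simp add: \<beta>_def tan_arctan)
    then have "sin \<beta> * v \<tau> = - w \<tau> * cos \<beta>"
      using \<open>cos \<beta> \<noteq> 0\<close> v_init by (simp add: tan_def field_simps)
    moreover have "angle0 = pi / 2 + \<beta>" by (simp only: angle0_def \<beta>_def)
    ultimately show ?thesis
      by (simp add: q_def \<phi>_def sin_add cos_add algebra_simps)
  qed
  then have "f \<tau> = 0" by (simp add: f_def)
  then have "f 0 = 0" using c[of 0] c[of \<tau>] \<tau>0 by simp
  moreover have "(w 0)\<^sup>2 + (v 0)\<^sup>2 \<noteq> 0" using nonzero[of 0] \<tau>0 by (metis atLeastAtMost_iff less_irrefl order_refl)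
  ultimately have "(q 0)\<^sup>2 = 0" unfolding f_def divide_eq_0_iff by blast
  then have "q 0 = 0" by simp
  then show ?thesis by (simp add: q_def \<phi>_def \<theta>_def)
qed

section \<open>A uniform time after which the energy is small\<close>

definition e0 :: real where "e0 = 4 + 2 * m * b"
definition W :: real where "W = 2 + e0"
text \<open>Weight of the cross term \<open>w * v\<close> in the Lyapunov function: small enough
  that the friction in the cross term costs at most \<open>m / 16 * v\<^sup>2\<close> after Young's
  inequality, and that the whole cross term is at most \<open>W\<close> in absolute value.\<close>

definition eps :: real where "eps = 1 / (4 * (1 + W))"
text \<open>The potential energy at \<open>w = - 1/10\<close>. Below this level the orbit stays to
  the right of \<open>- 1/10\<close>.\<close>

definition small :: real where "small = 2 * m * (exp (- (1/10)) - 9/10)"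
text \<open>Decay at rate \<open>(eps / 2) * small\<close> during this time exceeds
  \<open>e0 + 2 * W\<close>, the largest possible drop of the Lyapunov function. The value depends
  on \<open>m\<close> and \<open>b\<close> only, hence not on the shooting parameter.\<close>

definition T0 :: real where "T0 = 4 * (e0 + W) / (eps * small) + 1"

lemma e0_pos: "4 \<le> e0" and W_pos: "6 \<le> W" and eps_pos: "0 < eps"
proof -
  show "4 \<le> e0" using m1 b0 by (simp add: e0_def)
  then show "6 \<le> W" by (simp add: W_def)
  then show "0 < eps" by (simp add: eps_def)
qed

lemma small_pos: "0 < small"
proof -
  have "exp (- (1/10)) \<noteq> 1 + (- (1/10) :: real)"
  proof
    assume eq: "exp (- (1/10)) = 1 + (- (1/10) :: real)"
    \<comment> \<open>Squaring the tangent inequality at -1/20 gives 0.9025 instead of 0.9, which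
      makes the inequality at -1/10 strict.\<close>
    have "(1 + - (1/20 :: real))\<^sup>2 \<le> (exp (- (1/20)))\<^sup>2"
      by (intro power_mono exp_ge_add_one_self) auto
    also have "\<dots> = exp (- (1/10))" by (simp add: exp_double[symmetric])
    finally show False using eq by (simp add: power2_eq_square)
  qed
  with exp_ge_add_one_self[of "- (1/10) :: real"] have "exp (- (1/10)) > (9/10 :: real)" by linarith
  then show ?thesis using m1 by (simp add: small_def)
qed

lemma T0_pos: "1 \<le> T0"
  unfolding T0_def using e0_pos W_pos eps_pos small_pos by simp

lemma energy_init: "energy \<tau> \<le> e0"
proof -
  have "(v \<tau>)\<^sup>2 \<le> (5/2)\<^sup>2" using v_init by (intro power_mono) auto
  \<comment> \<open>For negative \<open>w\<close> the excess is at most \<open>- w\<close>, hence at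
    most \<open>b\<close>. The kinetic part is at most 25/8, which is below the 4 in
    \<open>e0\<close>.\<close>
  moreover have "2 * m * (exp (w \<tau>) - 1 - w \<tau>) \<le> 2 * m * b"
    using w_init m1 exp_le_one_iff[of "w \<tau>"] by (intro mult_left_mono) linarith+
  ultimately show ?thesis by (simp add: energy_def e0_def power2_eq_square)
qed

text \<open>The potential grows quadratically to the right and linearly to the left;
  \<open>W\<close> serves both, because \<open>4 * e0 \<le> W\<^sup>2\<close> and
  \<open>1 + e0 \<le> W\<close>.\<close>

lemma orbit_bounds:
  assumes t: "t \<in> {\<tau>..0}"
  shows "\<bar>w t\<bar> \<le> W" "\<bar>v t\<bar> \<le> W"
proof -
  have E: "energy t \<le> e0" using energy_antimono[of \<tau> t] energy_init t by auto
  have W2: "4 * e0 \<le> W\<^sup>2" using e0_pos by (simp add: W_def power2_eq_square algebra_simps)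
  have "(v t)\<^sup>2 \<le> W\<^sup>2" using v2_le[of t] E W2 e0_pos by linarith
  then show "\<bar>v t\<bar> \<le> W" using W_pos abs_le_square_iff[of "v t" W] by simp
  have ex: "2 * m * (exp (w t) - 1 - w t) \<le> e0" using excess_le[of t] E by linarith
  have "1 * (exp (w t) - 1 - w t) \<le> 2 * m * (exp (w t) - 1 - w t)"
    using m1 exp_minus_one_ge[of "w t"] by (intro mult_right_mono) auto
  from order_trans[OF this ex] have ex: "exp (w t) - 1 - w t \<le> e0" by simp
  show "\<bar>w t\<bar> \<le> W"
  proof (cases "0 \<le> w t")
    case True
    have "1 + w t + (w t)\<^sup>2 / 2 \<le> exp (w t)" by (rule exp_lower_Taylor_quadratic[OF True])
    then have "(w t)\<^sup>2 \<le> W\<^sup>2" using ex W2 e0_pos by linarith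
    then show ?thesis using W_pos abs_le_square_iff[of "w t" W] by simp
  next
    case False
    have "0 < exp (w t)" by simp
    then have "- w t \<le> W" using ex unfolding W_def by linarith
    then show ?thesis using False by simp
  qed
qed

text \<open>The cross term makes the damping act on \<open>w\<close> as well, so that the energy decays at a definite rate.\<close>

lemma lyapunov_deriv:
  assumes t: "t \<in> {\<tau>..0}" "t \<le> -1"
  shows "\<exists>y. ((\<lambda>t. energy t + eps * (w t * v t)) has_real_derivative y) (at t) \<and> y \<le> - (eps / 2) * energy t"
proof -
  define y where "y = m * tanh t * (v t)\<^sup>2
      + eps * ((v t)\<^sup>2 + w t * (m * tanh t * v t - 2 * m * (exp (w t) - 1)))"
  define g where "g = w t * (exp (w t) - 1)"
  define z where "z = (v t)\<^sup>2"
  have "((\<lambda>t. energy t + eps * (w t * v t)) has_real_derivative y) (at t)"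
    by (rule derivative_eq_intros energy_deriv[OF t(1)] dw[OF t(1)] dv[OF t(1)] refl)+
      (simp add: y_def algebra_simps power2_eq_square)
  moreover have "y \<le> - (eps / 2) * energy t"
  proof -
    have th: "tanh t \<le> - (1/2)" "- 1 < tanh t" using tanh_le_minus_half[OF t(2)] tanh_real_gt_neg1 by auto
    have "m * (tanh t * z) \<le> m * (- (1/2) * z)"
      using th m1 by (intro mult_left_mono mult_right_mono) (auto simp: z_def)
    \<comment> \<open>Young's inequality with weight \<open>1 + W\<close>: as
      \<open>\<bar>w t\<bar> \<le> W\<close>, the part in \<open>w\<close> is absorbed by the
      restoring term \<open>g\<close>.\<close>
    moreover have "w t * tanh t * v t \<le> g + (1 + W) / 4 * z"
    proof -
      have "w t * tanh t * v t \<le> \<bar>w t * tanh t * v t\<bar>" by simp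
      also have "\<dots> = \<bar>tanh t\<bar> * \<bar>w t * v t\<bar>" by (simp add: abs_mult)
      also have "\<dots> \<le> 1 * \<bar>w t * v t\<bar>" using th by (intro mult_right_mono) auto
      also have "\<dots> \<le> (w t)\<^sup>2 / (1 + W) + (1 + W) / 4 * (v t)\<^sup>2"
      proof -
        define k where "k = 1 + W"
        have k: "k > 0" using W_pos by (simp add: k_def)
        have "0 \<le> (\<bar>w t\<bar> / k - \<bar>v t\<bar> / 2)\<^sup>2 * k" using k by simp
        also have "\<dots> = (w t)\<^sup>2 / k + k / 4 * (v t)\<^sup>2 - \<bar>w t\<bar> * \<bar>v t\<bar>"
          using k by (simp add: power2_eq_square field_simps)
        finally show ?thesis by (simp add: k_def abs_mult)
      qed
      also have "(w t)\<^sup>2 / (1 + W) \<le> (w t)\<^sup>2 / (1 + \<bar>w t\<bar>)"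
        using orbit_bounds(1)[OF t(1)] by (intro divide_left_mono) auto
      also have "\<dots> \<le> g" unfolding g_def by (rule exp_diff_mult_ge)
      finally show ?thesis by (simp add: z_def)
    qed
    then have "eps * m * (w t * tanh t * v t) \<le> eps * m * (g + (1 + W) / 4 * z)"
      using eps_pos m1 by (intro mult_left_mono) auto
    moreover have "y = m * (tanh t * z) + eps * z + eps * m * (w t * tanh t * v t) - 2 * m * eps * g"
      by (simp add: y_def z_def g_def algebra_simps)
    ultimately have "y \<le> - (m / 2) * z + eps * z + eps * m * ((1 + W) / 4 * z) - m * eps * g"
      by (simp add: algebra_simps)
    also have "eps * m * ((1 + W) / 4 * z) = m / 16 * z"
      using W_pos by (simp add: eps_def field_simps)
    finally have y: "y \<le> - (m / 2) * z + eps * z + m / 16 * z - m * eps * g" .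
    have "eps \<le> 1 / 28" using W_pos by (simp add: eps_def divide_simps)
    then have "(eps + m / 16 + eps / 4) * z \<le> (m / 2) * z"
      using m1 by (intro mult_right_mono) (auto simp: z_def)
    moreover have "(eps / 2) * energy t \<le> (eps / 2) * (z / 2 + 2 * m * g)"
      using energy_le_quad[of t] eps_pos by (intro mult_left_mono) (auto simp: z_def g_def)
    ultimately show ?thesis using y by (simp add: algebra_simps)
  qed
  ultimately show ?thesis by blast
qed

lemma energy_becomes_small:
  assumes "\<tau> + T0 \<le> -1"
  shows "energy (\<tau> + T0) < small"
proof (rule ccontr)
  assume "\<not> ?thesis"
  then have big: "small \<le> energy t" if "\<tau> \<le> t" "t \<le> \<tau> + T0" for t
    using energy_antimono[of t "\<tau> + T0"] that assms by linarith
  define L where "L t = energy t + eps * (w t * v t) + (eps / 2) * small * t" for t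
  have "L (\<tau> + T0) \<le> L \<tau>"
  proof (rule DERIV_nonpos_imp_nonincreasing[where f = L])
    fix t assume t: "\<tau> \<le> t" "t \<le> \<tau> + T0"
    then obtain y where y: "((\<lambda>t. energy t + eps * (w t * v t)) has_real_derivative y) (at t)"
      "y \<le> - (eps / 2) * energy t" using lyapunov_deriv[of t] assms by auto
    have "(L has_real_derivative y + (eps / 2) * small) (at t)"
      unfolding L_def by (rule derivative_eq_intros y(1) refl)+ simp
    moreover have "(eps / 2) * small \<le> (eps / 2) * energy t"
      using big[OF t] eps_pos by (intro mult_left_mono) auto
    ultimately show "\<exists>y. (L has_real_derivative y) (at t) \<and> y \<le> 0" using y(2) by force
  qed (use T0_pos in simp)
  moreover have cross: "\<bar>eps * (w t * v t)\<bar> \<le> W" if "t \<in> {\<tau>..0}" for t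
  proof -
    have "\<bar>w t\<bar> * \<bar>v t\<bar> \<le> W * W" using orbit_bounds[OF that] by (intro mult_mono) auto
    then have "eps * (\<bar>w t\<bar> * \<bar>v t\<bar>) \<le> eps * (W * W)" using eps_pos by (intro mult_left_mono) auto
    also have "\<dots> \<le> W" using W_pos by (simp add: eps_def divide_simps)
    finally show ?thesis using eps_pos by (simp add: abs_mult)
  qed
  have "\<bar>eps * (w \<tau> * v \<tau>)\<bar> \<le> W" "\<bar>eps * (w (\<tau> + T0) * v (\<tau> + T0))\<bar> \<le> W"
    using \<tau>0 T0_pos assms by (auto intro!: cross)
  ultimately have "(eps / 2) * small * T0 \<le> e0 + 2 * W"
    using energy_init energy_nonneg[of "\<tau> + T0"] unfolding L_def distrib_left by linarith
  moreover have "(eps / 2) * small * T0 = 2 * (e0 + W) + (eps / 2) * small"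
    using eps_pos small_pos by (simp add: T0_def field_simps)
  ultimately show False using e0_pos eps_pos small_pos by (smt (verit) half_gt_zero_iff mult_pos_pos)
qed

section \<open>Upper bounds for the angular velocity and the total rotation\<close>

lemma rotation_le:
  assumes t: "t \<in> {\<tau>..0}"
  shows "rotation t \<le> m / 2"
proof -
  have "w t * tanh t * v t \<le> \<bar>w t * tanh t * v t\<bar>" by simp
  also have "\<dots> = \<bar>tanh t\<bar> * \<bar>w t * v t\<bar>" by (simp add: abs_mult)
  also have "\<dots> \<le> 1 * \<bar>w t * v t\<bar>" using tanh_real_bounds[of t] by (intro mult_right_mono) auto
  also have "\<dots> \<le> ((w t)\<^sup>2 + (v t)\<^sup>2) / 2"
    using sum_squares_bound[of "\<bar>w t\<bar>" "\<bar>v t\<bar>"] by (simp add: abs_mult)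
  finally have "m * (w t * tanh t * v t) \<le> m * (((w t)\<^sup>2 + (v t)\<^sup>2) / 2)"
    using m1 by (intro mult_left_mono) auto
  have "0 \<le> m * (w t * (exp (w t) - 1))"
    using m1 by (intro mult_nonneg_nonneg[of m] exp_diff_mult_nonneg) auto
  have "0 \<le> (v t)\<^sup>2" by simp
  have "w t * (m * tanh t * v t - 2 * m * (exp (w t) - 1)) - (v t)\<^sup>2 \<le> m / 2 * ((w t)\<^sup>2 + (v t)\<^sup>2)"
  proof -
    have "w t * (m * tanh t * v t - 2 * m * (exp (w t) - 1))
        = m * (w t * tanh t * v t) - 2 * (m * (w t * (exp (w t) - 1)))" by (simp add: algebra_simps)
    moreover have "m / 2 * ((w t)\<^sup>2 + (v t)\<^sup>2) = m * (((w t)\<^sup>2 + (v t)\<^sup>2) / 2)" by simp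
    ultimately show ?thesis using \<open>m * (w t * tanh t * v t) \<le> _\<close> \<open>0 \<le> m * (w t * (exp (w t) - 1))\<close>
        \<open>0 \<le> (v t)\<^sup>2\<close> by linarith
  qed
  then show ?thesis unfolding rotation_def using nonzero[OF t] by (simp add: pos_divide_le_eq)
qed

text \<open>For \<open>w > - 1/10\<close> the restoring term is at least
  \<open>10/11 * w\<^sup>2\<close>, where \<open>10/11 = 1 / (1 + 1/10)\<close>. The numerator of
  \<open>rotation\<close> is then at most the quadratic form
  \<open>m * (x * y) - 20 * m / 11 * x\<^sup>2 - y\<^sup>2\<close>, and for \<open>m \<le> 7\<close>
  this form is negative definite with a margin of 1/100.\<close>

lemma rotation_le_small:
  assumes t: "t \<in> {\<tau>..0}" and "energy t < small"
  shows "rotation t \<le> - (1/100)"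
proof -
  have "exp (w t) - 1 - w t < exp (- (1/10)) - 9/10"
  proof -
    have "2 * m * (exp (w t) - 1 - w t) < 2 * m * (exp (- (1/10)) - 9/10)"
      using excess_le[of t] assms(2) unfolding small_def by linarith
    then show ?thesis using m1 by (simp add: mult_less_cancel_left_pos)
  qed
  then have wlow: "- (1/10) < w t" using exp_excess_ge[of "w t" "1/10"] by (cases "w t \<le> - (1/10)") auto
  define x where "x = \<bar>w t\<bar>"
  define y where "y = \<bar>v t\<bar>"
  have g: "10/11 * x\<^sup>2 \<le> w t * (exp (w t) - 1)"
  proof (cases "w t \<ge> 0")
    case True
    then have "w t * w t \<le> w t * (exp (w t) - 1)" using exp_minus_one_ge[of "w t"] by (intro mult_left_mono) auto
    moreover have "10/11 * x\<^sup>2 \<le> x\<^sup>2" "x\<^sup>2 = w t * w t" by (auto simp: x_def power2_eq_square)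
    ultimately show ?thesis by linarith
  next
    case False
    then have "10/11 \<le> 1 / (1 + \<bar>w t\<bar>)" using wlow by (simp add: field_simps)
    from mult_right_mono[OF this, of "x\<^sup>2"] have "10/11 * x\<^sup>2 \<le> 1 / (1 + \<bar>w t\<bar>) * x\<^sup>2" by simp
    also have "\<dots> = (w t)\<^sup>2 / (1 + \<bar>w t\<bar>)" by (simp add: x_def)
    also have "\<dots> \<le> w t * (exp (w t) - 1)" by (rule exp_diff_mult_ge)
    finally show ?thesis .
  qed
  have "w t * tanh t * v t \<le> \<bar>w t * tanh t * v t\<bar>" by simp
  also have "\<dots> = \<bar>tanh t\<bar> * (x * y)" by (simp add: abs_mult x_def y_def)
  also have "\<dots> \<le> 1 * (x * y)" using tanh_real_bounds[of t] by (intro mult_right_mono) (auto simp: x_def y_def)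
  finally have 1: "m * (w t * tanh t * v t) \<le> m * (x * y)" using m1 by (intro mult_left_mono) auto
  have 2: "2 * m * (10/11 * x\<^sup>2) \<le> 2 * m * (w t * (exp (w t) - 1))"
    using g m1 by (intro mult_left_mono) auto
  have 3: "m * (x * y) \<le> 2 * m * (10/11 * x\<^sup>2) + y\<^sup>2 - (x\<^sup>2 + y\<^sup>2) / 100"
  proof -
    \<comment> \<open>The discriminant condition for the form. Replacing \<open>m\<^sup>2\<close> by
      its bound \<open>8 * m - 7\<close> makes it linear in \<open>m\<close>. The fractions 50/99
      and 25/99 come from completing the square with leading coefficient
      \<open>99/100 = 1 - 1/100\<close>.\<close>
    have "0 \<le> (m - 1) * (7 - m)" using m1 m7 by (intro mult_nonneg_nonneg) auto
    then have "m\<^sup>2 \<le> 8 * m - 7" by (simp add: power2_eq_square algebra_simps)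
    then have "0 \<le> 20 * m / 11 - 1/100 - m\<^sup>2 * (25/99)" using m7 by simp
    then have "0 \<le> (20 * m / 11 - 1/100 - m\<^sup>2 * (25/99)) * x\<^sup>2" by simp
    also have "\<dots> = 2 * m * (10/11 * x\<^sup>2) - x\<^sup>2 / 100 - m\<^sup>2 * x\<^sup>2 * (25/99)"
      by (simp add: left_diff_distrib)
    finally have 1: "0 \<le> 2 * m * (10/11 * x\<^sup>2) - x\<^sup>2 / 100 - m\<^sup>2 * x\<^sup>2 * (25/99)" .
    have "0 \<le> 99/100 * (y - m * x * (50/99))\<^sup>2" by simp
    also have "\<dots> = 99/100 * y\<^sup>2 - m * (x * y) + m\<^sup>2 * x\<^sup>2 * (25/99)"
      by (simp add: power2_diff power_mult_distrib power_divide field_simps)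
    finally show ?thesis using 1 by (simp add: field_simps)
  qed
  have xy: "x\<^sup>2 = (w t)\<^sup>2" "y\<^sup>2 = (v t)\<^sup>2" by (auto simp: x_def y_def)
  have "w t * (m * tanh t * v t - 2 * m * (exp (w t) - 1)) - (v t)\<^sup>2
     \<le> - (1/100) * ((w t)\<^sup>2 + (v t)\<^sup>2)"
  proof -
    have eq: "w t * (m * tanh t * v t - 2 * m * (exp (w t) - 1))
        = m * (w t * tanh t * v t) - 2 * m * (w t * (exp (w t) - 1))" by (simp add: algebra_simps)
    have "N - V \<le> - ((U + V) / 100)"
      if "N = M - R" "M \<le> P" "Q \<le> R" "P \<le> Q + Y - (X + Y) / 100" "X = U" "Y = V"
      for N M R P Q X Y U V :: real using that by (simp add: field_simps)
    from this[OF eq 1 2 3 xy] show ?thesis by simp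
  qed
  then show ?thesis unfolding rotation_def using nonzero[OF t] by (simp only: pos_divide_le_eq)
qed

lemma integral_rotation_le:
  assumes "\<tau> \<le> s" "s \<le> t" "t \<le> 0" "\<And>x. x \<in> {s..t} \<Longrightarrow> rotation x \<le> c"
  shows "integral {s..t} rotation \<le> c * (t - s)"
proof -
  have "integral {s..t} rotation \<le> integral {s..t} (\<lambda>x. c)"
    using assms by (intro integral_le integrable_rotation) auto
  then show ?thesis using assms by (simp add: mult.commute)
qed

text \<open>An early orbit turns forward by at most \<open>m / 2 * T0\<close> until its energy is
  small, and from then on backward with speed at least 1/100. An orbit with
  \<open>\<tau> > - 1 - T0\<close> moves for a time of at most \<open>T0 + 1\<close>, and the
  additional \<open>T0 + 1\<close> in the bound outweighs the negative term
  \<open>\<tau> / 100\<close>.\<close>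

lemma total_rotation: "integral {\<tau>..0} rotation \<le> (m / 2 + 1) * (T0 + 1) + \<tau> / 100"
proof (cases "\<tau> + T0 \<le> -1")
  case True
  let ?s = "\<tau> + T0"
  have "integral {\<tau>..0} rotation = integral {\<tau>..?s} rotation + integral {?s..0} rotation"
    using True T0_pos by (intro Henstock_Kurzweil_Integration.integral_combine[symmetric] integrable_rotation) auto
  also have "integral {\<tau>..?s} rotation \<le> m / 2 * (?s - \<tau>)"
    using True T0_pos by (intro integral_rotation_le rotation_le) auto
  also have "integral {?s..0} rotation \<le> - (1/100) * (0 - ?s)"
  proof (intro integral_rotation_le rotation_le_small)
    fix x assume "x \<in> {?s..0}"
    then show "energy x < small"
      using energy_becomes_small[OF True] energy_antimono[of ?s x] T0_pos by auto
  qed (use True T0_pos in auto)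
  finally have "integral {\<tau>..0} rotation \<le> m / 2 * T0 + \<tau> / 100 + T0 / 100" by (simp add: diff_divide_distrib add_divide_distrib)
  moreover have "(m / 2 + 1) * (T0 + 1) = m / 2 * T0 + m / 2 + T0 + 1" by (simp add: algebra_simps)
  ultimately show ?thesis using T0_pos m1 by linarith
next
  case False
  have "integral {\<tau>..0} rotation \<le> m / 2 * (0 - \<tau>)"
    using \<tau>0 by (intro integral_rotation_le rotation_le) auto
  also have "\<dots> \<le> m / 2 * (T0 + 1)" using False m1 by (intro mult_left_mono) auto
  finally have "integral {\<tau>..0} rotation \<le> m / 2 * (T0 + 1)" .
  moreover have "(m / 2 + 1) * (T0 + 1) = m / 2 * (T0 + 1) + T0 + 1" by (simp add: algebra_simps)
  ultimately show ?thesis using False T0_pos by linarith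
qed

lemma angle_upper: "angle0 + integral {\<tau>..0} rotation \<le> pi + (m / 2 + 1) * (T0 + 1) + \<tau> / 100"
  using total_rotation arctan_ubound[of "- w \<tau> / v \<tau>"] by (simp add: angle0_def)

end

section \<open>Energy bounds and Emden variables\<close>

text \<open>Smoothness up to the endpoints requires the truncation to be inactive on an open
  neighbourhood of \<open>{0..c}\<close>. For \<open>c \<le> 1\<close> the limit 1/2 on the margin
  keeps this neighbourhood inside the interval where the coefficients are not clamped.\<close>

lemma strict_bound_margin:
  fixes f :: "real \<Rightarrow> real"
  assumes f: "continuous_on UNIV f" and "0 \<le> c" and less: "\<And>x. x \<in> {0..c} \<Longrightarrow> f x < M"
  shows "\<exists>\<delta>. 0 < \<delta> \<and> \<delta> \<le> 1/2 \<and> (\<forall>x\<in>{-\<delta><..<c+\<delta>}. f x < M)"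
proof -
  have "open {x. f x < M}" by (intro open_Collect_less f continuous_on_const)
  then have nbhd: "\<exists>e>0. ball x e \<subseteq> {x. f x < M}" if "x \<in> {0..c}" for x
    using less[OF that] unfolding open_contains_ball by simp
  obtain e1 e2 where e: "e1 > 0" "ball 0 e1 \<subseteq> {x. f x < M}" "e2 > 0" "ball c e2 \<subseteq> {x. f x < M}"
    using nbhd[of 0] nbhd[of c] \<open>0 \<le> c\<close> by auto
  define \<delta> where "\<delta> = min (min e1 e2) (1/2)"
  have "f x < M" if x: "x \<in> {-\<delta><..<c+\<delta>}" for x
  proof -
    have "x \<in> ball 0 e1 \<or> x \<in> ball c e2 \<or> x \<in> {0..c}"
      using x by (auto simp: \<delta>_def dist_real_def abs_if)
    then show ?thesis using e less by blast
  qed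
  then show ?thesis using e by (intro exI[of _ \<delta>]) (auto simp: \<delta>_def)
qed

lemma gronwall_zero:
  fixes S :: "real \<Rightarrow> real"
  assumes "0 \<le> x" and "S 0 = 0"
    and S: "\<And>y. 0 \<le> y \<Longrightarrow> y \<le> x \<Longrightarrow> \<exists>D. (S has_real_derivative D) (at y) \<and> D \<le> M * S y"
  shows "S x \<le> 0"
proof -
  have "S x * exp (- M * x) \<le> S 0 * exp (- M * 0)"
  proof (rule DERIV_nonpos_imp_nonincreasing[where f = "\<lambda>y. S y * exp (- M * y)"])
    fix y assume "0 \<le> y" "y \<le> x"
    then obtain D where D: "(S has_real_derivative D) (at y)" "D \<le> M * S y" using S by blast
    have "((\<lambda>y. S y * exp (- M * y)) has_real_derivative (D - M * S y) * exp (- M * y)) (at y)"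
      by (rule derivative_eq_intros D(1) refl)+ (simp add: algebra_simps)
    moreover have "(D - M * S y) * exp (- M * y) \<le> 0" using D(2) by (intro mult_nonpos_nonneg) auto
    ultimately show "\<exists>D. ((\<lambda>y. S y * exp (- M * y)) has_real_derivative D) (at y) \<and> D \<le> 0" by blast
  qed fact
  then show ?thesis using assms(2) by (simp add: mult_le_0_iff)
qed

context shooting
begin

lemma sol_domain:
  assumes "\<forall>x\<in>{-\<delta><..<c+\<delta>}. sol x a < a + 1" "0 < \<delta>" "\<delta> \<le> 1/2" "0 \<le> c" "c \<le> 1"
    and "r \<in> {-\<delta><..<c+\<delta>}"
  shows "((\<lambda>x. dsol x a) has_real_derivative deriv (\<lambda>x. dsol x a) r) (at r)"
    and "r * (2 - r) * deriv (\<lambda>x. dsol x a) r + (real m + 2) * (1 - r) * dsol r a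
           + 2 * (real m + 1) * (exp (sol r a) - 1) = 0"
    and "smooth_upto n (\<lambda>x. sol x a) {-\<delta><..<c+\<delta>}"
  by (rule sol_smooth_and_ode[of "{-\<delta><..<c+\<delta>}"]; use assms in force)+

text \<open>Suppose the solution exceeds \<open>a\<close>. Up to the first point \<open>c\<close>
  where it reaches a level \<open>\<beta>\<close> strictly between \<open>a\<close> and
  \<open>a + 1\<close> the truncation is inactive, and the energy \<open>e\<close> does not
  increase, since the friction coefficient \<open>m + 2\<close> outweighs the growth of the factor
  \<open>x * (2 - x)\<close>. Comparing \<open>e\<close> at 0 and \<open>c\<close> contradicts the
  strict monotonicity of \<open>exp x - x\<close> for positive \<open>x\<close>.\<close>

lemma sol_le:
  assumes a: "1 \<le> a" and r: "r \<in> {0..1}"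
  shows "sol r a \<le> a"
proof (rule ccontr)
  assume "\<not> ?thesis"
  then have gt: "a < sol r a" by simp
  define \<beta> where "\<beta> = min (sol r a) (a + 1/2)"
  have \<beta>: "a < \<beta>" "\<beta> < a + 1" "\<beta> \<le> sol r a" using gt by (auto simp: \<beta>_def)
  have cont: "continuous_on S (\<lambda>x. sol x a)" for S by (intro continuous_intros)
  define S where "S = {x \<in> {0..r}. sol x a = \<beta>}"
  have "closed S" unfolding S_def
    by (intro continuous_closed_preimage_constant cont) auto
  moreover have "S \<noteq> {}"
    using IVT'[of "\<lambda>x. sol x a" 0 \<beta> r] r \<beta> sol_0[of a] cont by (auto simp: S_def)
  moreover have bdd: "bdd_below S" by (auto simp: S_def bdd_below_def)
  ultimately have InfS: "Inf S \<in> S" by (simp add: closed_contains_Inf)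
  define c where "c = Inf S"
  have c: "0 \<le> c" "c \<le> r" "sol c a = \<beta>" using InfS by (auto simp: S_def c_def)
  have below: "sol x a \<le> \<beta>" if x: "x \<in> {0..c}" for x
  proof (rule ccontr)
    assume "\<not> ?thesis"
    then obtain y where "0 \<le> y" "y \<le> x" "sol y a = \<beta>"
      using IVT'[of "\<lambda>x. sol x a" 0 \<beta> x, OF _ _ _ cont] x \<beta> sol_0[of a]
      unfolding atLeastAtMost_iff by (metis less_imp_le linear)
    moreover from this have "y \<in> S" using x c by (auto simp: S_def)
    then have "c \<le> y" unfolding c_def using bdd by (rule cInf_lower)
    ultimately have "y = x" using x by auto
    then show False using \<open>\<not> sol x a \<le> \<beta>\<close> \<open>sol y a = \<beta>\<close> by simp
  qed
  obtain \<delta> where \<delta>: "0 < \<delta>" "\<delta> \<le> 1/2" "\<forall>x\<in>{-\<delta><..<c+\<delta>}. sol x a < a + 1"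
    using strict_bound_margin[OF cont c(1), of "a + 1"] below \<beta> by (meson le_less_trans)
  define e where "e x = x * (2 - x) * (dsol x a)\<^sup>2 / 2 + 2 * (real m + 1) * (exp (sol x a) - sol x a)" for x
  have "e c \<le> e 0"
  proof (rule DERIV_nonpos_imp_nonincreasing[where f = e, OF c(1)])
    fix x assume x: "0 \<le> x" "x \<le> c"
    have x': "x \<in> {-\<delta><..<c+\<delta>}" using x \<delta> by auto
    have c1: "c \<le> 1" using c r by auto
    define d where "d = deriv (\<lambda>x. dsol x a) x"
    note D = sol_domain(1)[OF \<delta>(3) \<delta>(1,2) c(1) c1 x', folded d_def]
      and ode = sol_domain(2)[OF \<delta>(3) \<delta>(1,2) c(1) c1 x', folded d_def]
    have e': "(e has_real_derivative (1 - x) * (dsol x a)\<^sup>2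
       + dsol x a * (x * (2 - x) * d + 2 * (real m + 1) * (exp (sol x a) - 1))) (at x)"
      unfolding e_def
      by (auto intro!: derivative_eq_intros sol_has_derivative D simp: field_simps power2_eq_square)
    have eq: "x * (2 - x) * d + 2 * (real m + 1) * (exp (sol x a) - 1) = - ((real m + 2) * (1 - x) * dsol x a)"
      using ode by linarith
    have "(e has_real_derivative (1 - x) * (dsol x a)\<^sup>2 - (real m + 2) * (1 - x) * (dsol x a)\<^sup>2) (at x)"
      by (rule DERIV_cong[OF e']) (simp only: eq, simp add: power2_eq_square algebra_simps)
    moreover have "(1 - x) * (dsol x a)\<^sup>2 \<le> (real m + 2) * ((1 - x) * (dsol x a)\<^sup>2)"
      using x c1 mult_right_mono[of 1 "real m + 2" "(1 - x) * (dsol x a)\<^sup>2"] by simp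
    ultimately show "\<exists>y. (e has_real_derivative y) (at x) \<and> y \<le> 0" by (auto simp: mult.assoc)
  qed
  moreover have "2 * (real m + 1) * (exp \<beta> - \<beta>) \<le> e c"
    using c r by (simp add: e_def)
  moreover have "e 0 = 2 * (real m + 1) * (exp a - a)" by (simp add: e_def sol_0)
  ultimately have "2 * (real m + 1) * (exp \<beta> - \<beta>) \<le> 2 * (real m + 1) * (exp a - a)" by linarith
  then have "exp \<beta> - \<beta> \<le> exp a - a" by (rule mult_left_le_imp_le) simp
  moreover have "exp a * (1 + (\<beta> - a)) \<le> exp a * exp (\<beta> - a)"
    by (intro mult_left_mono exp_ge_add_one_self) auto
  then have "exp a * (\<beta> - a) \<le> exp \<beta> - exp a" by (simp add: exp_add[symmetric] algebra_simps)
  moreover have "\<beta> - a < exp a * (\<beta> - a)" using a \<beta> by simp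
  ultimately show False by simp
qed

lemma ex_margin:
  assumes "1 \<le> a"
  shows "\<exists>\<delta>. 0 < \<delta> \<and> \<delta> \<le> 1/2 \<and> (\<forall>x\<in>{-\<delta><..<1+\<delta>}. sol x a < a + 1)"
proof (rule strict_bound_margin)
  show "continuous_on UNIV (\<lambda>x. sol x a)" by (intro continuous_intros)
qed (use sol_le[OF assms] in force)+

lemma ode_unit:
  assumes "1 \<le> a" "r \<in> {0..1}"
  shows "((\<lambda>x. dsol x a) has_real_derivative deriv (\<lambda>x. dsol x a) r) (at r)"
    and "r * (2 - r) * deriv (\<lambda>x. dsol x a) r + (real m + 2) * (1 - r) * dsol r a
           + 2 * (real m + 1) * (exp (sol r a) - 1) = 0"
proof -
  obtain \<delta> where \<delta>: "0 < \<delta>" "\<delta> \<le> 1/2" "\<forall>x\<in>{-\<delta><..<1+\<delta>}. sol x a < a + 1"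
    using ex_margin[OF assms(1)] by blast
  have "r \<in> {-\<delta><..<1+\<delta>}" using assms \<delta> by auto
  then show "((\<lambda>x. dsol x a) has_real_derivative deriv (\<lambda>x. dsol x a) r) (at r)"
    "r * (2 - r) * deriv (\<lambda>x. dsol x a) r + (real m + 2) * (1 - r) * dsol r a
           + 2 * (real m + 1) * (exp (sol r a) - 1) = 0"
    using sol_domain[of \<delta> 1 a r, OF \<delta>(3) \<delta>(1,2)] by simp_all
qed

lemma dsol_bound:
  assumes a: "1 \<le> a" and r: "r \<in> {0..1}"
  shows "\<bar>dsol r a\<bar> \<le> K * exp a"
  unfolding dsol_def
proof (rule slope_bound)
  show "continuous_on UNIV (\<lambda>x. sol x a)" by (intro continuous_intros)
  fix s :: real assume s: "s \<in> {0..1}"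
  let ?y = "sol (r * s\<^sup>2) a"
  have "r * s\<^sup>2 \<in> {0..1}" using r s by (auto simp: power_le_one mult_le_one)
  from sol_le[OF a this] have "exp (min ?y (a + 1)) \<le> exp a" by simp
  moreover have "0 < exp (min ?y (a + 1))" "1 \<le> exp a" using a by auto
  ultimately show "\<bar>exp (min ?y (a + 1)) - 1\<bar> \<le> exp a" by linarith
qed simp

lemma sol_ge:
  assumes a: "1 \<le> a" and r: "r \<in> {0..1}"
  shows "a - K * exp a * r \<le> sol r a"
proof -
  have "sol 0 a + K * exp a * 0 \<le> sol r a + K * exp a * r"
  proof (rule DERIV_nonneg_imp_nondecreasing[where f = "\<lambda>x. sol x a + K * exp a * x"])
    fix x assume "0 \<le> x" "x \<le> r"
    then have "\<bar>dsol x a\<bar> \<le> K * exp a" using dsol_bound[OF a, of x] r by auto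
    moreover have "((\<lambda>x. sol x a + K * exp a * x) has_real_derivative dsol x a + K * exp a) (at x)"
      by (rule derivative_eq_intros sol_has_derivative refl)+ simp
    ultimately show "\<exists>y. ((\<lambda>x. sol x a + K * exp a * x) has_real_derivative y) (at x) \<and> 0 \<le> y"
      by (intro exI[of _ "dsol x a + K * exp a"]) linarith
  qed (use r in auto)
  then show ?thesis by (simp add: sol_0)
qed

text \<open>
  In the coordinate \<open>t\<close> with \<open>cos \<theta> = - tanh t\<close>, where \<open>\<theta>\<close> is the polar angle, subtract the
  singular solution \<open>- 2 ln (sin \<theta>) + ln (m / (m + 1))\<close>, which comes from the solution
  \<open>- 2 ln \<bar>x'\<bar> + const\<close> depending on one variable less and is symmetric about the equator.
\<close>

definition orb_w :: "real \<Rightarrow> real \<Rightarrow> real" where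
  "orb_w a t = sol (1 + tanh t) a + (ln (1 - (tanh t)\<^sup>2) + ln ((real m + 1) / real m))"

definition orb_v :: "real \<Rightarrow> real \<Rightarrow> real" where
  "orb_v a t = dsol (1 + tanh t) a * (1 - (tanh t)\<^sup>2) - 2 * tanh t"

lemma sech2_pos: "0 < 1 - (tanh (t::real))\<^sup>2"
  using tanh_real_bounds[of t] by (simp add: abs_square_less_1 abs_if)

lemma orb_w_deriv: "(orb_w a has_real_derivative orb_v a t) (at t)"
proof -
  have 1: "((\<lambda>t. 1 + tanh t) has_real_derivative 1 - (tanh t)\<^sup>2) (at t)"
    by (auto intro!: derivative_eq_intros)
  have "((\<lambda>t. ln (1 - (tanh t)\<^sup>2)) has_real_derivative - 2 * tanh t) (at t)"
    using sech2_pos[of t] by (auto intro!: derivative_eq_intros simp: field_simps)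
  from DERIV_add[OF DERIV_compose[OF sol_has_derivative 1] DERIV_add[OF this DERIV_const]]
  show ?thesis unfolding orb_w_def orb_v_def
    by (rule DERIV_cong) (simp add: mult.commute)
qed

text \<open>The change of variable lowers the friction coefficient from \<open>m + 2\<close> to
  \<open>m\<close>. The terms in \<open>1 - (tanh t)\<^sup>2\<close> that it leaves, together with
  those from the singular solution, add up to the constant \<open>2 * m\<close>.\<close>

lemma orb_v_deriv:
  assumes a: "1 \<le> a" and t: "t \<le> 0"
  shows "(orb_v a has_real_derivative real m * tanh t * orb_v a t - 2 * real m * (exp (orb_w a t) - 1)) (at t)"
proof -
  define r where "r = 1 + tanh t"
  define d where "d = deriv (\<lambda>x. dsol x a) r"
  define T where "T = tanh t"
  have r: "r \<in> {0..1}" using t tanh_real_bounds[of t] by (auto simp: r_def)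
  have 3: "(tanh has_real_derivative 1 - T\<^sup>2) (at t)"
    by (auto intro!: derivative_eq_intros simp: T_def)
  have 1: "((\<lambda>t. 1 + tanh t) has_real_derivative 1 - T\<^sup>2) (at t)"
    by (auto intro!: derivative_eq_intros simp: T_def)
  have 2: "((\<lambda>t. dsol (1 + tanh t) a) has_real_derivative (1 - T\<^sup>2) * d) (at t)"
    by (rule DERIV_compose[where f = "\<lambda>x. dsol x a", OF _ 1])
      (use ode_unit(1)[OF a r] in \<open>simp add: r_def d_def\<close>)
  have der: "(orb_v a has_real_derivative
      (1 - T\<^sup>2) * d * (1 - T\<^sup>2) + dsol r a * (- 2 * T * (1 - T\<^sup>2)) - 2 * (1 - T\<^sup>2)) (at t)"
    unfolding orb_v_def
    by (rule DERIV_cong[OF DERIV_diff[OF DERIV_mult[OF 2 DERIV_diff[OF DERIV_const DERIV_power[OF 3]]] DERIV_cmult[OF 3]]])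
      (simp add: T_def r_def)
  have eq: "(1 - T\<^sup>2) * d * (1 - T\<^sup>2) + dsol r a * (- 2 * T * (1 - T\<^sup>2)) - 2 * (1 - T\<^sup>2)
      = real m * T * orb_v a t - 2 * real m * (exp (orb_w a t) - 1)"
  proof -
    define S where "S = 1 - T\<^sup>2"
    have "r * (2 - r) = S" by (simp add: r_def T_def S_def power2_eq_square algebra_simps)
    moreover have "1 - r = - T" by (simp add: r_def T_def)
    ultimately have "S * d = (real m + 2) * T * dsol r a - 2 * (real m + 1) * (exp (sol r a) - 1)"
      using ode_unit(2)[OF a r, folded d_def] \<open>1 - r = - T\<close> by simp
    then have SdS: "S * d * S = ((real m + 2) * T * dsol r a - 2 * (real m + 1) * (exp (sol r a) - 1)) * S"
      by (rule arg_cong)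
    have v: "orb_v a t = dsol r a * S - 2 * T" by (simp add: orb_v_def r_def S_def T_def)
    have "T * T = 1 - S" by (simp add: S_def power2_eq_square)
    then have "real m * T * (2 * T) = 2 * real m * (1 - S)" by simp
    then have mTv: "real m * T * orb_v a t = real m * T * (dsol r a * S) - 2 * real m * (1 - S)"
      unfolding v right_diff_distrib by simp
    have mexp: "real m * exp (orb_w a t) = (real m + 1) * exp (sol r a) * S"
      using sech2_pos[of t] m1 by (simp add: orb_w_def exp_add r_def S_def T_def)
    have "2 * real m * (exp (orb_w a t) - 1) = 2 * (real m * exp (orb_w a t)) - 2 * real m"
      by (simp add: algebra_simps)
    also note mexp
    finally have mw: "2 * real m * (exp (orb_w a t) - 1) = 2 * ((real m + 1) * exp (sol r a) * S) - 2 * real m" .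
    show ?thesis unfolding S_def[symmetric] SdS mTv mw by (simp add: algebra_simps)
  qed
  show ?thesis using DERIV_cong[OF der eq] unfolding T_def .
qed

text \<open>Fixes the starting point at \<open>r\<close> comparable to \<open>exp (- a)\<close>. The
  summand \<open>8 * K\<close> makes \<open>K * exp a * exp (- c0 - a)\<close> at most 1/8, so that
  up to there \<open>V\<close> drops by at most 1/4 and \<open>dsol\<close> contributes at most 1/2
  to \<open>orb_v\<close>. The summand 9 exceeds \<open>4 * 2\<close>, which forces
  \<open>w < 0\<close> at the start.\<close>

definition c0 :: real where "c0 = ln (8 * K + 9)"
definition start :: "real \<Rightarrow> real" where "start a = - (a + c0) / 2"

lemma exp_c0: "exp c0 = 8 * K + 9" using K_pos by (simp add: c0_def)

lemma c0_ge: "1 \<le> c0"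
proof -
  have "exp 1 \<le> exp c0" using exp_le K_pos unfolding exp_c0 by linarith
  then show ?thesis by simp
qed

lemma one_plus_tanh_start:
  assumes a: "1 \<le> a"
  shows "exp (- c0 - a) \<le> 1 + tanh (start a)" "1 + tanh (start a) \<le> 2 * exp (- c0 - a)"
    "1 + tanh (start a) \<le> 1"
proof -
  define y where "y = exp (- c0 - a)"
  have y: "0 < y" "y \<le> 1" using a c0_ge by (auto simp: y_def)
  have "- 2 * start a = - (- c0 - a)" by (simp add: start_def)
  then have e: "exp (- 2 * start a) = 1 / y" unfolding y_def by (metis exp_minus inverse_eq_divide)
  have "1 + tanh (start a) = 2 * y / (y + 1)"
  proof -
    have "(1 - 1 / y) / (1 + 1 / y) = ((y - 1) / y) / ((y + 1) / y)" using y by (simp add: diff_divide_distrib add_divide_distrib)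
    also have "\<dots> = (y - 1) / (y + 1)" using y by simp
    finally show ?thesis unfolding tanh_real_altdef e using y by (simp add: add_divide_eq_iff)
  qed
  moreover have "y \<le> 2 * y / (y + 1)" "2 * y / (y + 1) \<le> 2 * y"
    using y by (auto simp: field_simps mult_left_le)
  ultimately show "y \<le> 1 + tanh (start a)" "1 + tanh (start a) \<le> 2 * y" by auto
  show "1 + tanh (start a) \<le> 1" using a c0_ge by (simp add: start_def)
qed

text \<open>The bounds on the starting point are free of \<open>a\<close>, because the value
  \<open>a\<close> of the solution cancels against \<open>ln (1 - (tanh t)\<^sup>2)\<close>, which
  is \<open>- a\<close> up to a bounded error.\<close>

lemma damped_orbit_orb:
  assumes a: "1 \<le> a"
  shows "damped_orbit (real m) (1 + c0) (start a) (orb_w a) (orb_v a)"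
proof
  show "1 \<le> real m" "real m \<le> 7" using m1 m7 by auto
  show "0 \<le> 1 + c0" "start a \<le> 0" using c0_ge a by (auto simp: start_def)
  show "(orb_w a has_real_derivative orb_v a t) (at t)" for t by (rule orb_w_deriv)
  show "(orb_v a has_real_derivative real m * tanh t * orb_v a t - 2 * real m * (exp (orb_w a t) - 1)) (at t)"
    if "t \<in> {start a..0}" for t using orb_v_deriv[OF a] that by simp
  define r where "r = 1 + tanh (start a)"
  define y where "y = exp (- c0 - a)"
  define S where "S = 1 - (tanh (start a))\<^sup>2"
  have r: "y \<le> r" "r \<le> 2 * y" "r \<le> 1" "0 < y"
    using one_plus_tanh_start[OF a] by (auto simp: r_def y_def)
  then have r01: "r \<in> {0..1}" by auto
  have S: "S = r * (2 - r)" by (simp add: S_def r_def power2_eq_square algebra_simps)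
  have "r * 1 \<le> S" "S \<le> r * 2" unfolding S using r by (auto intro!: mult_left_mono)
  then have S': "y \<le> S" "S \<le> 4 * y" using r by auto
  have "exp a * y = exp (- c0)" unfolding y_def mult_exp_exp by simp
  then have ey: "exp a * y = 1 / (8 * K + 9)" by (metis exp_minus inverse_eq_divide exp_c0)
  have Kr: "K * exp a * r \<le> 1/4" and KS: "K * exp a * S \<le> 1/2"
  proof -
    have Ky: "K * (exp a * y) \<le> 1/8" unfolding ey using K_pos by (simp add: field_simps)
    have "K * exp a * r \<le> K * exp a * (2 * y)" using r K_pos by (intro mult_left_mono) auto
    then show "K * exp a * r \<le> 1/4" using Ky by simp
    have "K * exp a * S \<le> K * exp a * (4 * y)" using S' K_pos by (intro mult_left_mono) auto
    then show "K * exp a * S \<le> 1/2" using Ky by simp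
  qed
  have w: "orb_w a (start a) = sol r a + (ln S + ln ((real m + 1) / real m))"
    by (simp add: orb_w_def r_def S_def)
  have "0 \<le> ln ((real m + 1) / real m)" using m1 by simp
  moreover have "- c0 - a \<le> ln S"
    using S' r by (metis less_le_trans ln_exp ln_le_cancel_iff y_def)
  moreover have "a - 1/4 \<le> sol r a" using sol_ge[OF a r01] Kr by linarith
  ultimately show "- (1 + c0) \<le> orb_w a (start a)" unfolding w by linarith
  have "ln ((real m + 1) / real m) \<le> ln 2" using m1 by (subst ln_le_cancel_iff) (auto simp: field_simps)
  moreover have "ln S \<le> ln 4 + (- c0 - a)"
  proof -
    have "ln S \<le> ln (4 * y)" using S' r by (subst ln_le_cancel_iff) auto
    then show ?thesis using r by (simp add: ln_mult y_def)
  qed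
  moreover have "ln 4 + ln 2 < c0"
  proof -
    have "ln (4 * 2 :: real) = ln 4 + ln 2" by (subst ln_mult) auto
    then have "ln 4 + ln 2 = ln (8 :: real)" by simp
    also have "\<dots> < c0" unfolding c0_def using K_pos by (subst ln_less_cancel_iff) auto
    finally show ?thesis .
  qed
  ultimately show "orb_w a (start a) < 0" unfolding w using sol_le[OF a r01] by linarith
  have "\<bar>dsol r a * S\<bar> \<le> K * exp a * S"
    unfolding abs_mult using dsol_bound[OF a r01] S' r by (intro mult_mono) auto
  then have "\<bar>dsol r a * S\<bar> \<le> 1/2" using KS by linarith
  moreover have "start a \<le> -1" using a c0_ge by (simp add: start_def)
  then have "tanh (start a) \<le> - (1/2)" by (rule tanh_le_minus_half)
  moreover have "- 1 < tanh (start a)" by (rule tanh_real_gt_neg1)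
  moreover have "orb_v a (start a) = dsol r a * S - 2 * tanh (start a)"
    by (simp add: orb_v_def r_def S_def)
  ultimately show "1/2 \<le> orb_v a (start a)" "orb_v a (start a) \<le> 5/2" by linarith+
qed

end

section \<open>Symmetric solutions by shooting\<close>

text \<open>Transfers the rotation integral from an interval that moves with \<open>a\<close> to a
  fixed one, where continuity in \<open>a\<close> is that of a parametric integral.\<close>

lemma integral_rescale:
  fixes f :: "real \<Rightarrow> real"
  assumes "\<tau> < 0" "f integrable_on {\<tau>..0}"
  shows "integral {\<tau>..0} f = - \<tau> * integral {0..1} (\<lambda>s. f (\<tau> * s))"
proof -
  have "(\<lambda>x. (1 / \<tau>) *\<^sub>R x + - ((1 / \<tau>) *\<^sub>R 0)) ` cbox \<tau> 0 = {0..1}"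
    using assms(1) by (auto simp: image_iff field_simps mult_nonneg_nonpos intro!: bexI[of _ "\<tau> * _"])
  with has_integral_affinity[OF integrable_integral, of f \<tau> 0 \<tau> 0] assms
  have "((\<lambda>s. f (\<tau> * s)) has_integral (1 / \<bar>\<tau>\<bar>) * integral {\<tau>..0} f) {0..1}" by simp
  from integral_unique[OF this] show ?thesis using assms(1) by simp
qed

context shooting
begin

lemma continuous_on_orb_w [continuous_intros]:
  "continuous_on S p \<Longrightarrow> continuous_on S q \<Longrightarrow> continuous_on S (\<lambda>x. orb_w (p x) (q x))"
  unfolding orb_w_def using sech2_pos by (intro continuous_intros) (auto simp: less_le)

lemma continuous_on_orb_v [continuous_intros]:
  "continuous_on S p \<Longrightarrow> continuous_on S q \<Longrightarrow> continuous_on S (\<lambda>x. orb_v (p x) (q x))"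
  unfolding orb_v_def by (intro continuous_intros) auto

abbreviation "rot a \<equiv> damped_orbit.rotation (real m) (orb_w a) (orb_v a)"

definition total_angle :: "real \<Rightarrow> real" where
  "total_angle a = damped_orbit.angle0 (start a) (orb_w a) (orb_v a) + integral {start a..0} (rot a)"

lemma start_neg: "1 \<le> a \<Longrightarrow> start a < 0"
  using c0_ge by (simp add: start_def)

lemma continuous_total_angle: "continuous_on {1..} total_angle"
proof -
  define R where "R a t = (orb_w a t * (real m * tanh t * orb_v a t - 2 * real m * (exp (orb_w a t) - 1))
      - (orb_v a t)\<^sup>2) / ((orb_w a t)\<^sup>2 + (orb_v a t)\<^sup>2)" for a t
  have cs: "continuous_on S p \<Longrightarrow> continuous_on S (\<lambda>x. start (p x))" for S :: "'x::topological_space set" and p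
    unfolding start_def by (intro continuous_intros) auto
  have "continuous_on ({1..} \<times> cbox 0 1) (\<lambda>(a, s). R a (start a * s))"
  proof -
    have "(orb_w a (start a * s))\<^sup>2 + (orb_v a (start a * s))\<^sup>2 \<noteq> 0" if "1 \<le> a" "s \<in> {0..1}" for a s
    proof -
      have "start a * s \<in> {start a..0}"
        using start_neg[OF that(1)] that(2) mult_left_mono_neg[of s 1 "start a"]
        by (auto simp: mult_nonpos_nonneg)
      from damped_orbit.nonzero[OF damped_orbit_orb[OF that(1)] this] show ?thesis by (metis less_irrefl)
    qed
    then show ?thesis unfolding R_def case_prod_unfold
      by (intro continuous_intros cs) auto
  qed
  from integral_continuous_on_param[OF this]
  have "continuous_on {1..} (\<lambda>a. integral {0..1} (\<lambda>s. R a (start a * s)))" by simp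
  moreover have "orb_v a (start a) \<noteq> 0" if "1 \<le> a" for a
    using damped_orbit.v_init[OF damped_orbit_orb[OF that]] by auto
  ultimately have "continuous_on {1..} (\<lambda>a. pi / 2 + arctan (- orb_w a (start a) / orb_v a (start a))
      + - start a * integral {0..1} (\<lambda>s. R a (start a * s)))"
    by (intro continuous_intros cs) auto
  then show ?thesis
  proof (rule continuous_on_eq)
    fix a :: real assume "a \<in> {1..}"
    then have a: "1 \<le> a" by simp
    interpret damped_orbit "real m" "1 + c0" "start a" "orb_w a" "orb_v a" by (rule damped_orbit_orb[OF a])
    have "rotation = R a" by (rule ext) (simp add: R_def rotation_def)
    moreover have "rotation integrable_on {start a..0}" by (intro integrable_rotation) auto
    ultimately show "pi / 2 + arctan (- orb_w a (start a) / orb_v a (start a))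
      + - start a * integral {0..1} (\<lambda>s. R a (start a * s)) = total_angle a"
      using start_neg[OF a] by (simp add: total_angle_def angle0_def integral_rescale)
  qed
qed

text \<open>Intermediate value theorem: by \<open>angle_upper\<close> the angle is at most
  \<open>C + start a / 100 = C - (a + c0) / 200\<close>, and \<open>C\<close> does not depend on
  \<open>a\<close>.\<close>

lemma total_angle_surj:
  assumes "y \<le> total_angle 1"
  shows "\<exists>a\<ge>1. total_angle a = y"
proof -
  define C where "C = pi + (real m / 2 + 1) * (damped_orbit.T0 (real m) (1 + c0) + 1)"
  define M where "M = max 1 (200 * (C - y))"
  have M: "1 \<le> M" "200 * (C - y) \<le> M" by (auto simp: M_def)
  have "total_angle M \<le> C + start M / 100"
    using damped_orbit.angle_upper[OF damped_orbit_orb[OF M(1)]] by (simp add: total_angle_def C_def)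
  also have "\<dots> \<le> y"
  proof -
    have 1: "start M / 100 = - ((M + c0) / 200)"
      by (simp add: start_def add_divide_distrib diff_divide_distrib)
    have 2: "C - y \<le> (M + c0) / 200"
      using M c0_ge by (subst pos_le_divide_eq) auto
    have "C + - q \<le> y" if "C - y \<le> q" for q using that by simp
    from this[OF 2] show ?thesis unfolding 1 .
  qed
  finally have "\<exists>a\<ge>1. a \<le> M \<and> total_angle a = y"
    using assms M(1) by (intro IVT2' continuous_on_subset[OF continuous_total_angle]) auto
  then show ?thesis by blast
qed

lemma dsol_zero_at_multiple:
  assumes a: "1 \<le> a" and eq: "total_angle a = - (real n * pi)"
  shows "dsol 1 a = 0"
proof -
  have "orb_w a 0 * sin (total_angle a) = orb_v a 0 * cos (total_angle a)"
    using damped_orbit.angle_end[OF damped_orbit_orb[OF a]] by (simp add: total_angle_def)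
  moreover have "sin (total_angle a) = 0" "cos (total_angle a) \<noteq> 0" unfolding eq by (auto simp: cos_npi)
  ultimately have "orb_v a 0 = 0" by simp
  \<comment> \<open>At the equator \<open>tanh 0 = 0\<close>, so the contribution of the singular
    solution to \<open>orb_v\<close> vanishes.\<close>
  then show ?thesis by (simp add: orb_v_def)
qed

lemma ex_initial_values: "\<exists>\<alpha>::nat \<Rightarrow> real. inj \<alpha> \<and> (\<forall>k. 1 \<le> \<alpha> k \<and> dsol 1 (\<alpha> k) = 0)"
proof -
  \<comment> \<open>The multiples of pi are shifted so that all of them lie below the angle of the
    first orbit.\<close>
  obtain k0 :: nat where k0: "- total_angle 1 / pi \<le> real k0" using real_arch_simple by blast
  have "\<forall>k. \<exists>a\<ge>1. total_angle a = - (real (k + k0) * pi)"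
  proof (intro allI total_angle_surj)
    fix k
    have "- total_angle 1 \<le> real k0 * pi" using k0 pos_divide_le_eq[OF pi_gt_zero] by blast
    moreover have "0 \<le> real k * pi" by simp
    ultimately show "- (real (k + k0) * pi) \<le> total_angle 1"
      unfolding of_nat_add distrib_right by linarith
  qed
  then obtain \<alpha> where \<alpha>: "\<forall>k. 1 \<le> \<alpha> k \<and> total_angle (\<alpha> k) = - (real (k + k0) * pi)"
    by (metis (no_types))
  have "inj \<alpha>"
  proof (rule injI)
    fix j k assume "\<alpha> j = \<alpha> k"
    then have "- (real (j + k0) * pi) = - (real (k + k0) * pi)" using \<alpha> by metis
    then show "j = k" by simp
  qed
  moreover have "dsol 1 (\<alpha> k) = 0" for k
    by (rule dsol_zero_at_multiple[of _ "k + k0"]) (use \<alpha> in blast)+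
  ultimately show ?thesis using \<alpha> by blast
qed

text \<open>Uniqueness for the initial value problem at the equator, a regular point of the
  equation. The difference \<open>h\<close> of the solution and its reflection and its derivative
  \<open>g\<close> vanish there, and Gronwall's inequality for \<open>h\<^sup>2 + g\<^sup>2\<close>
  applies because the leading coefficient \<open>1 - y\<^sup>2\<close> is at least 3/4 when
  \<open>\<delta> \<le> 1/2\<close>.\<close>

lemma sol_even_at_equator:
  assumes "0 < \<delta>" "\<delta> \<le> 1/2" and below: "\<forall>x\<in>{-\<delta><..<1+\<delta>}. sol x a < a + 1"
    and zero: "dsol 1 a = 0" and x: "0 \<le> x" "x < \<delta>"
  shows "sol (1 + x) a = sol (1 - x) a"
proof -
  define d where "d r = deriv (\<lambda>x. dsol x a) r" for r
  define h where "h x = sol (1 + x) a - sol (1 - x) a" for x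
  define g where "g x = dsol (1 + x) a + dsol (1 - x) a" for x
  define k where "k = 2 * (real m + 1)"
  define C where "C = 4/3 * (real m + 2 + k * exp (a + 1))"
  define S where "S x = (h x)\<^sup>2 + (g x)\<^sup>2" for x
  have "S x \<le> 0"
  proof (rule gronwall_zero[OF x(1)])
    show "S 0 = 0" by (simp add: S_def h_def g_def zero)
    fix y assume y: "0 \<le> y" "y \<le> x"
    have yp: "1 + y \<in> {-\<delta><..<1+\<delta>}" and ym: "1 - y \<in> {-\<delta><..<1+\<delta>}" using x y assms by auto
    have D: "((\<lambda>x. dsol x a) has_real_derivative d r) (at r)"
      and O: "r * (2 - r) * d r + (real m + 2) * (1 - r) * dsol r a + 2 * (real m + 1) * (exp (sol r a) - 1) = 0"
      if "r \<in> {-\<delta><..<1+\<delta>}" for r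
      using sol_domain(1,2)[OF below assms(1,2) _ _ that] by (simp_all add: d_def)
    have p: "((\<lambda>y. 1 + y) has_real_derivative 1) (at y)" "((\<lambda>y. 1 - y) has_real_derivative - 1) (at y)"
      by (auto intro!: derivative_eq_intros)
    have dh: "(h has_real_derivative g y) (at y)" unfolding h_def g_def
      by (rule DERIV_cong[OF DERIV_diff[OF DERIV_compose[OF sol_has_derivative p(1)] DERIV_compose[OF sol_has_derivative p(2)]]]) simp
    have dg: "(g has_real_derivative d (1 + y) - d (1 - y)) (at y)" unfolding g_def
      using yp ym
      by (intro DERIV_cong[OF DERIV_add[OF DERIV_compose[where f = "\<lambda>x. dsol x a", OF D p(1)]
          DERIV_compose[where f = "\<lambda>x. dsol x a", OF D p(2)]]]) auto
    define h2 where "h2 = d (1 + y) - d (1 - y)"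
    have "(1 - y\<^sup>2) * d (1 + y) = (real m + 2) * y * dsol (1 + y) a - k * (exp (sol (1 + y) a) - 1)"
      using O[of "1 + y"] yp by (simp add: k_def power2_eq_square algebra_simps)
    moreover have "(1 - y\<^sup>2) * d (1 - y) = - ((real m + 2) * y * dsol (1 - y) a) - k * (exp (sol (1 - y) a) - 1)"
      using O[of "1 - y"] ym by (simp add: k_def power2_eq_square algebra_simps)
    ultimately have eq: "(1 - y\<^sup>2) * h2 = (real m + 2) * y * g y - k * (exp (sol (1 + y) a) - exp (sol (1 - y) a))"
      by (simp add: h2_def g_def algebra_simps)
    have y2: "3/4 \<le> 1 - y\<^sup>2"
    proof -
      have "y\<^sup>2 \<le> (1/2)\<^sup>2" using y x assms by (intro power_mono) auto
      then show ?thesis by (simp add: power2_eq_square)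
    qed
    have "\<bar>exp (sol (1 + y) a) - exp (sol (1 - y) a)\<bar> \<le> exp (a + 1) * \<bar>h y\<bar>"
      using exp_min_lipschitz[of "sol (1 + y) a" "a + 1" "sol (1 - y) a"] bspec[OF below yp] bspec[OF below ym]
      by (simp add: h_def min_def)
    then have "k * \<bar>exp (sol (1 + y) a) - exp (sol (1 - y) a)\<bar> \<le> k * (exp (a + 1) * \<bar>h y\<bar>)"
      by (intro mult_left_mono) (auto simp: k_def)
    moreover have "\<bar>(real m + 2) * y * g y\<bar> \<le> (real m + 2) * 1 * \<bar>g y\<bar>"
      unfolding abs_mult using y x assms by (intro mult_mono) auto
    moreover have "\<bar>(1 - y\<^sup>2) * h2\<bar> \<le> \<bar>(real m + 2) * y * g y\<bar> + k * \<bar>exp (sol (1 + y) a) - exp (sol (1 - y) a)\<bar>"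
      unfolding eq by (rule order_trans[OF abs_triangle_ineq4]) (simp add: abs_mult k_def)
    moreover have "3/4 * \<bar>h2\<bar> \<le> \<bar>(1 - y\<^sup>2) * h2\<bar>"
      unfolding abs_mult using y2 by (intro mult_right_mono) auto
    ultimately have "3/4 * \<bar>h2\<bar> \<le> (real m + 2) * \<bar>g y\<bar> + k * exp (a + 1) * \<bar>h y\<bar>" by argo
    moreover have "0 \<le> (real m + 2) * \<bar>h y\<bar>" "0 \<le> k * exp (a + 1) * \<bar>g y\<bar>" by (auto simp: k_def)
    ultimately have *: "3/4 * \<bar>h2\<bar> \<le> (real m + 2) * \<bar>g y\<bar> + k * exp (a + 1) * \<bar>h y\<bar>"
      "0 \<le> (real m + 2) * \<bar>h y\<bar>" "0 \<le> k * exp (a + 1) * \<bar>g y\<bar>" by blast+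
    have h2: "\<bar>h2\<bar> \<le> C * (\<bar>g y\<bar> + \<bar>h y\<bar>)"
    proof -
      have "C * (\<bar>g y\<bar> + \<bar>h y\<bar>) = 4/3 * ((real m + 2) * \<bar>g y\<bar> + (real m + 2) * \<bar>h y\<bar>
          + (k * exp (a + 1) * \<bar>g y\<bar> + k * exp (a + 1) * \<bar>h y\<bar>))"
        unfolding C_def by (simp add: algebra_simps add_divide_distrib)
      moreover have "c \<le> 4/3 * (p + q + (s + t))" if "3/4 * c \<le> p + t" "0 \<le> q" "0 \<le> s" for c p q s t :: real
        using that by (simp add: field_simps)
      ultimately show ?thesis using * by (simp only:)
    qed
    have C0: "0 \<le> C" by (simp add: C_def k_def)
    have gh2: "2 * (\<bar>g y\<bar> * \<bar>h y\<bar>) \<le> S y"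
      using sum_squares_bound[of "\<bar>g y\<bar>" "\<bar>h y\<bar>"] unfolding S_def power2_abs by linarith
    have gg: "\<bar>g y\<bar> * \<bar>g y\<bar> \<le> S y" by (simp add: S_def power2_eq_square)
    have "0 \<le> \<bar>g y\<bar> * \<bar>h y\<bar>" by simp
    with gh2 have gh: "\<bar>g y\<bar> * \<bar>h y\<bar> \<le> S y" by linarith
    have "(S has_real_derivative 2 * g y * (h y + h2)) (at y)"
      unfolding S_def h2_def
      by (rule derivative_eq_intros dh dg refl)+ (simp add: algebra_simps)
    moreover have "2 * g y * (h y + h2) \<le> (1 + 4 * C) * S y"
    proof -
      have "2 * g y * (h y + h2) \<le> \<bar>2 * g y * (h y + h2)\<bar>" by simp
      also have "\<dots> = 2 * (\<bar>g y\<bar> * \<bar>h y + h2\<bar>)" by (simp add: abs_mult)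
      also have "\<dots> \<le> 2 * (\<bar>g y\<bar> * (\<bar>h y\<bar> + C * (\<bar>g y\<bar> + \<bar>h y\<bar>)))"
        using h2 by (intro mult_left_mono) auto
      also have "\<dots> = 2 * (\<bar>g y\<bar> * \<bar>h y\<bar>) + 2 * (C * (\<bar>g y\<bar> * \<bar>g y\<bar>)) + 2 * (C * (\<bar>g y\<bar> * \<bar>h y\<bar>))"
        by (simp add: algebra_simps)
      also have "\<dots> \<le> S y + 2 * (C * S y) + 2 * (C * S y)"
        by (intro add_mono mult_left_mono gh gg gh2 C0) auto
      finally show ?thesis by (simp add: algebra_simps)
    qed
    ultimately show "\<exists>D. (S has_real_derivative D) (at y) \<and> D \<le> (1 + 4 * C) * S y" by blast
  qed
  then have "(h x)\<^sup>2 + (g x)\<^sup>2 \<le> 0" by (simp add: S_def)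
  then have "h x = 0" by (simp add: sum_power2_le_zero_iff)
  then show ?thesis by (simp add: h_def)
qed

definition profile :: "real \<Rightarrow> real \<Rightarrow> real" where "profile a z = sol (1 - \<bar>z\<bar>) a"

text \<open>The absolute value in \<open>profile\<close> hides two smooth descriptions,
  \<open>sol (1 - z) a\<close> for \<open>z > - \<delta>\<close> and \<open>sol (1 + z) a\<close>
  for \<open>z < \<delta>\<close>. They agree across the equator by evenness; the sign
  \<open>s\<close> treats both at once.\<close>

lemma profile_props:
  assumes a: "1 \<le> a" and zero: "dsol 1 a = 0"
  shows "\<exists>I. open I \<and> {-1..1} \<subseteq> I \<and> (\<forall>n. smooth_upto n (profile a) I) \<and>
    (\<forall>z\<in>{-1..1}. (1 - z\<^sup>2) * deriv (deriv (profile a)) z - (real m + 2) * z * deriv (profile a) z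
       + 2 * (real m + 1) * (exp (profile a z) - 1) = 0)"
proof -
  obtain \<delta> where \<delta>: "0 < \<delta>" "\<delta> \<le> 1/2" and below: "\<forall>x\<in>{-\<delta><..<1+\<delta>}. sol x a < a + 1"
    using ex_margin[OF a] by blast
  define J where "J = {-\<delta><..<1+\<delta>}"
  have ev: "sol (1 + x) a = sol (1 - x) a" if "0 \<le> x" "x < \<delta>" for x
    using that by (intro sol_even_at_equator[OF \<delta> below zero])
  have D: "((\<lambda>x. dsol x a) has_real_derivative deriv (\<lambda>x. dsol x a) r) (at r)"
    and O: "r * (2 - r) * deriv (\<lambda>x. dsol x a) r + (real m + 2) * (1 - r) * dsol r a
      + 2 * (real m + 1) * (exp (sol r a) - 1) = 0"
    if "r \<in> J" for r
    using sol_domain(1,2)[OF below \<delta>, of r] that by (simp_all add: J_def)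
  have sm: "smooth_upto n (\<lambda>x. sol x a) J" for n
    using sol_domain(3)[OF below \<delta>, of 0] \<delta> by (simp add: J_def)
  define I where "I s = {z. 1 - s * z \<in> J}" for s :: real
  have openI: "open (I s)" for s
  proof -
    have "open ((\<lambda>z. 1 - s * z) -` J)" unfolding J_def by (intro open_vimage continuous_intros)
    then show ?thesis by (simp add: I_def vimage_def)
  qed
  have prof: "profile a z = sol (1 + - s * z) a" if "s \<in> {-1, 1}" "z \<in> I s" for s z
  proof -
    have abs: "\<bar>z\<bar> = \<bar>s * z\<bar>" using that(1) by auto
    have low: "- \<delta> < s * z" using that(2) by (simp add: I_def J_def)
    show ?thesis
    proof (cases "0 \<le> s * z")
      case True
      then show ?thesis by (simp add: profile_def abs)
    next
      case False
      then have "\<bar>z\<bar> = - (s * z)" by (simp add: abs)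
      then show ?thesis using ev[of "- (s * z)"] False low by (simp add: profile_def)
    qed
  qed
  have smI: "smooth_upto n (profile a) (I s)" if s: "s \<in> {-1, 1}" for n s
  proof -
    have "smooth_upto n (\<lambda>z. sol (1 + - s * z) a) (I s)"
      by (rule smooth_upto_affine[where S = J and f = "\<lambda>x. sol x a"])
        (use sm openI in \<open>auto simp: I_def J_def\<close>)
    then show ?thesis by (rule smooth_upto_cong[OF openI, rotated]) (simp add: prof[OF s, simplified])
  qed
  have odeI: "(1 - z\<^sup>2) * deriv (deriv (profile a)) z - (real m + 2) * z * deriv (profile a) z
       + 2 * (real m + 1) * (exp (profile a z) - 1) = 0" if s: "s \<in> {-1, 1}" and z: "z \<in> I s" for s z
  proof -
    define r where "r z = 1 + - s * z" for z
    have dr: "(r has_real_derivative - s) (at z)" for z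
      unfolding r_def by (auto intro!: derivative_eq_intros)
    have d1: "deriv (profile a) z = - s * dsol (r z) a" if "z \<in> I s" for z
    proof (rule DERIV_imp_deriv, rule has_field_derivative_transform_within_open[OF _ openI that])
      show "((\<lambda>z. sol (r z) a) has_real_derivative - s * dsol (r z) a) (at z)"
        by (rule DERIV_compose[OF sol_has_derivative dr])
    qed (simp add: r_def prof[OF s, simplified])
    have rz: "r z \<in> J" using z by (simp add: r_def I_def)
    have d2: "deriv (deriv (profile a)) z = - s * (- s * deriv (\<lambda>x. dsol x a) (r z))"
    proof (rule DERIV_imp_deriv, rule has_field_derivative_transform_within_open[OF _ openI z])
      show "((\<lambda>z. - s * dsol (r z) a) has_real_derivative - s * (- s * deriv (\<lambda>x. dsol x a) (r z))) (at z)"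
        by (intro DERIV_cmult DERIV_compose[where f = "\<lambda>x. dsol x a", OF _ dr] D rz)
    qed (simp add: d1)
    have "r z * (2 - r z) = 1 - (s * z) * (s * z)" by (simp add: r_def algebra_simps)
    also have "(s * z) * (s * z) = z\<^sup>2" using s by (auto simp: power2_eq_square)
    finally have "r z * (2 - r z) = 1 - z\<^sup>2" "1 - r z = s * z"
      "- s * (- s * deriv (\<lambda>x. dsol x a) (r z)) = deriv (\<lambda>x. dsol x a) (r z)"
      using s by (auto simp: r_def)
    note eqs = this
    have pz: "profile a z = sol (r z) a" using prof[OF s z] by (simp add: r_def)
    have "(1 - z\<^sup>2) * deriv (deriv (profile a)) z - (real m + 2) * z * deriv (profile a) z
       + 2 * (real m + 1) * (exp (profile a z) - 1)
       = r z * (2 - r z) * deriv (\<lambda>x. dsol x a) (r z) + (real m + 2) * (1 - r z) * dsol (r z) a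
      + 2 * (real m + 1) * (exp (sol (r z) a) - 1)"
      unfolding d1[OF z] d2 pz eqs by (simp add: mult.assoc mult.left_commute)
    then show ?thesis using O[OF rz] by simp
  qed
  have sub: "{-1..1} \<subseteq> I 1 \<union> I (-1)" using \<delta> by (auto simp: I_def J_def)
  show ?thesis
  proof (intro exI[of _ "I 1 \<union> I (-1)"] conjI ballI allI)
    show "open (I 1 \<union> I (-1))" by (intro open_Un openI)
    show "smooth_upto n (profile a) (I 1 \<union> I (-1))" for n
      by (intro smooth_upto_Un openI smI) auto
    fix z :: real assume "z \<in> {-1..1}"
    then have "z \<in> I 1 \<or> z \<in> I (-1)" using sub by auto
    then show "(1 - z\<^sup>2) * deriv (deriv (profile a)) z - (real m + 2) * z * deriv (profile a) z
       + 2 * (real m + 1) * (exp (profile a z) - 1) = 0"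
      using odeI[of 1 z] odeI[of "-1" z] by blast
  qed fact
qed

end

text \<open>The value at 1 is the shooting height at the pole. Its injectivity in \<open>k\<close>
  will separate the solutions, and its being nonzero will exclude constant profiles.\<close>

lemma ex_profiles:
  assumes "1 \<le> m" "m \<le> 7"
  shows "\<exists>f :: nat \<Rightarrow> real \<Rightarrow> real. inj (\<lambda>k. f k 1) \<and> (\<forall>k. 1 \<le> f k 1 \<and>
    (\<exists>I. open I \<and> {-1..1} \<subseteq> I \<and> (\<forall>n. smooth_upto n (f k) I) \<and>
      (\<forall>z\<in>{-1..1}. (1 - z\<^sup>2) * deriv (deriv (f k)) z - (real m + 2) * z * deriv (f k) z
         + 2 * (real m + 1) * (exp (f k z) - 1) = 0)))"
proof -
  interpret shooting m by unfold_locales (use assms in auto)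
  obtain \<alpha> :: "nat \<Rightarrow> real" where \<alpha>: "inj \<alpha>" "\<And>k. 1 \<le> \<alpha> k" "\<And>k. dsol 1 (\<alpha> k) = 0"
    using ex_initial_values by blast
  have one: "profile (\<alpha> k) 1 = \<alpha> k" for k by (simp add: profile_def sol_0)
  show ?thesis
  proof (intro exI[of _ "\<lambda>k. profile (\<alpha> k)"] conjI allI)
    show "inj (\<lambda>k. profile (\<alpha> k) 1)" unfolding one by fact
    show "1 \<le> profile (\<alpha> k) 1" for k unfolding one by fact
  qed (rule profile_props[OF \<alpha>(2,3)])
qed

section \<open>Homogeneous solutions of the partial differential equation\<close>

lemma has_derivative_imp_partial_deriv:
  assumes "(f has_derivative D) (at x)"
  shows "partial_deriv i f x = D (axis i 1)"
  unfolding partial_deriv_def by (rule fun_cong[OF frechet_derivative_at[OF assms, symmetric]])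

text \<open>Since \<open>frechet_derivative\<close> is a choice, the two derivative predicates are
  shown equal; this covers points without differentiability too.\<close>

lemma partial_deriv_cong:
  assumes "open S" "x \<in> S" "\<And>y. y \<in> S \<Longrightarrow> f y = g y"
  shows "partial_deriv i f x = partial_deriv i g x"
proof -
  have "(f has_derivative D) (at x) \<longleftrightarrow> (g has_derivative D) (at x)" for D
  proof
    assume "(f has_derivative D) (at x)"
    then show "(g has_derivative D) (at x)"
      by (rule has_derivative_transform_within_open[OF _ assms(1,2)]) (rule assms(3))
  next
    assume "(g has_derivative D) (at x)"
    then show "(f has_derivative D) (at x)"
      by (rule has_derivative_transform_within_open[OF _ assms(1,2)]) (rule assms(3)[symmetric])
  qed
  then have "(\<lambda>D. (f has_derivative D) (at x)) = (\<lambda>D. (g has_derivative D) (at x))" by (rule ext)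
  then show ?thesis unfolding partial_deriv_def frechet_derivative_def by (rule arg_cong)
qed

lemma C_k_on_cong:
  assumes S: "open S"
  shows "C_k_on k f S \<Longrightarrow> (\<And>x. x \<in> S \<Longrightarrow> f x = g x) \<Longrightarrow> C_k_on k g S"
proof (induction k arbitrary: f g)
  case 0
  then show ?case by (auto intro: continuous_on_eq)
next
  case (Suc k)
  have "g differentiable (at x)" if x: "x \<in> S" for x
  proof -
    obtain D where "(f has_derivative D) (at x)"
      using Suc.prems(1) x by (auto simp: differentiable_def)
    then have "(g has_derivative D) (at x)"
      by (rule has_derivative_transform_within_open[OF _ S x]) (rule Suc.prems(2))
    then show ?thesis by (auto simp: differentiable_def)
  qed
  moreover have "C_k_on k (partial_deriv i g) S" for i
  proof (rule Suc.IH)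
    show "C_k_on k (partial_deriv i f) S" using Suc.prems(1) by simp
    show "partial_deriv i f x = partial_deriv i g x" if "x \<in> S" for x
      using Suc.prems(2) by (rule partial_deriv_cong[OF S that])
  qed
  ultimately show ?case by simp
qed

lemma has_derivative_component: "((\<lambda>y. y $ i) has_derivative (\<lambda>h. h $ i)) (at (x :: real^'n))"
  by (rule bounded_linear_imp_has_derivative[OF bounded_linear_vec_nth])

lemma continuous_on_component: "continuous_on S (\<lambda>y :: real^'n. y $ e)"
  by (rule linear_continuous_on[OF bounded_linear_vec_nth])

lemma open_component_vimage:
  assumes "open I"
  shows "open {y :: real^'n. y $ e \<in> I}"
  using open_vimage[OF assms continuous_on_component[of UNIV e]] by (simp add: vimage_def)

text \<open>The constant factor is carried along for the induction, because each partial derivative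
  multiplies by \<open>axis i 1 $ e\<close>.\<close>

lemma C_k_on_compose_component:
  assumes I: "open I"
  shows "smooth_upto k f I \<Longrightarrow> C_k_on k (\<lambda>y :: real^'n. c * f (y $ e)) {y. y $ e \<in> I}"
proof (induction k arbitrary: f c)
  case 0
  then have "continuous_on I f" by simp
  then have "continuous_on {y :: real^'n. y $ e \<in> I} (\<lambda>y. f (y $ e))"
    by (rule continuous_on_compose2[OF _ continuous_on_component]) auto
  then show ?case by (auto intro!: continuous_intros)
next
  case (Suc k)
  let ?S = "{y :: real^'n. y $ e \<in> I}"
  have S: "open ?S" by (rule open_component_vimage[OF I])
  have D: "((\<lambda>y. c * f (y $ e)) has_derivative (\<lambda>h. c * (h $ e * deriv f (y $ e)))) (at y)" if "y \<in> ?S" for y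
  proof -
    have "(f has_real_derivative deriv f (y $ e)) (at (y $ e))"
      using that Suc.prems by (simp add: DERIV_deriv_iff_field_differentiable)
    from has_derivative_mult_right[OF DERIV_compose_FDERIV[OF this has_derivative_component]]
    show ?thesis .
  qed
  have "C_k_on k (partial_deriv i (\<lambda>y. c * f (y $ e))) ?S" for i
  proof -
    have "C_k_on k (\<lambda>y. (c * axis i 1 $ e) * deriv f (y $ e)) ?S"
      by (rule Suc.IH) (use Suc.prems in simp)
    then show ?thesis
    proof (rule C_k_on_cong[OF S])
    fix y assume "y \<in> ?S"
    from has_derivative_imp_partial_deriv[OF D[OF this], of i]
    show "c * axis i 1 $ e * deriv f (y $ e) = partial_deriv i (\<lambda>y. c * f (y $ e)) y"
      by (simp only: mult.assoc)
    qed
  qed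
  then show ?case using D by (auto simp: differentiable_def)
qed

lemma inverse_norm_has_derivative:
  fixes x :: "real^'n"
  assumes "x \<noteq> 0"
  shows "((\<lambda>x. inverse (norm x)) has_derivative (\<lambda>h. - ((x \<bullet> h) * inverse (norm x) ^ 3))) (at x)"
proof -
  have "(norm has_derivative (\<lambda>h. h \<bullet> sgn x)) (at x)"
    by (rule has_derivative_norm[OF assms])
  from DERIV_compose_FDERIV[OF DERIV_inverse this] assms
  have "((\<lambda>x. inverse (norm x)) has_derivative (\<lambda>h. (h \<bullet> sgn x) * - (inverse (norm x) ^ Suc (Suc 0)))) (at x)"
    by simp
  moreover have "(h \<bullet> sgn x) * - (inverse (norm x) ^ Suc (Suc 0)) = - ((x \<bullet> h) * inverse (norm x) ^ 3)" for h
    by (simp add: sgn_div_norm inner_commute power3_eq_cube divide_inverse)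
  ultimately show ?thesis by simp
qed

lemma axis_one: "axis i (1::real) $ e = (if i = e then 1 else 0)" "x \<bullet> axis i (1::real) = x $ i"
  by (simp add: axis_def, simp add: inner_axis)

section \<open>The function on the punctured space generated by a profile\<close>

locale homogeneous_profile =
  fixes f :: "real \<Rightarrow> real" and I :: "real set" and e :: "'n::finite" and c :: real
  assumes I: "open I" "{-1..1} \<subseteq> I" and smooth: "\<And>n. smooth_upto n f I"
begin

definition U :: "real^'n \<Rightarrow> real" where
  "U x = - 2 * ln (norm x) + c + f (x $ e * inverse (norm x))"

abbreviation "R \<equiv> \<lambda>x::real^'n. inverse (norm x)"
abbreviation "Z \<equiv> \<lambda>x::real^'n. x $ e * inverse (norm x)"
abbreviation "\<delta> \<equiv> \<lambda>i. if i = e then 1 else (0::real)"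

lemma Z_mem: "Z x \<in> {-1..1}"
proof -
  have "\<bar>Z x\<bar> \<le> 1"
    using component_le_norm_cart[of x e] by (cases "x = 0") (auto simp: abs_mult field_simps)
  then show ?thesis by auto
qed

lemma Z_in_I: "Z x \<in> I" using Z_mem I by blast

lemma f_deriv: "(f has_real_derivative deriv f (Z x)) (at (Z x))"
  using smooth_upto_derivative[OF smooth[of "Suc 0"] Z_in_I] .

lemma f_deriv2: "(deriv f has_real_derivative deriv (deriv f) (Z x)) (at (Z x))"
  using smooth[of "Suc (Suc 0)"] Z_in_I[of x] by (simp add: DERIV_deriv_iff_field_differentiable)

definition DZ :: "real^'n \<Rightarrow> real^'n \<Rightarrow> real" where
  "DZ x h = h $ e * R x - x $ e * (x \<bullet> h) * R x ^ 3"

lemma Z_has_derivative: "x \<noteq> 0 \<Longrightarrow> (Z has_derivative DZ x) (at x)"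
  by (rule has_derivative_eq_rhs[OF has_derivative_mult[OF has_derivative_component inverse_norm_has_derivative]])
    (auto simp: DZ_def)

definition P :: "'n \<Rightarrow> real^'n \<Rightarrow> real" where
  "P i x = - 2 * (x $ i * R x ^ 2) + deriv f (Z x) * (\<delta> i * R x - x $ e * x $ i * R x ^ 3)"

lemma U_has_derivative:
  assumes x: "x \<noteq> 0"
  shows "(U has_derivative (\<lambda>h. - 2 * ((x \<bullet> h) * R x ^ 2) + DZ x h * deriv f (Z x))) (at x)"
proof -
  have "(norm has_derivative (\<lambda>h. h \<bullet> sgn x)) (at x)"
    by (rule has_derivative_norm[OF x])
  from DERIV_compose_FDERIV[OF _ this, of ln "inverse (norm x)"] x
  have "((\<lambda>x. ln (norm x)) has_derivative (\<lambda>h. (h \<bullet> sgn x) * inverse (norm x))) (at x)"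
    by (simp add: DERIV_ln)
  then have "((\<lambda>x. ln (norm x)) has_derivative (\<lambda>h. (x \<bullet> h) * R x ^ 2)) (at x)"
    by (simp add: sgn_div_norm inner_commute power2_eq_square mult_ac)
  from has_derivative_add[OF has_derivative_add[OF has_derivative_mult_right[OF this, of "- 2"] has_derivative_const[of c]]
      DERIV_compose_FDERIV[OF f_deriv Z_has_derivative[OF x]]]
  show ?thesis unfolding U_def[abs_def] by simp
qed

lemma partial_U: "x \<noteq> 0 \<Longrightarrow> partial_deriv i U x = P i x"
  using has_derivative_imp_partial_deriv[OF U_has_derivative, of x i]
  by (simp add: P_def DZ_def axis_one mult.commute)

definition Q :: "'n \<Rightarrow> real^'n \<Rightarrow> real^'n \<Rightarrow> real" where
  "Q i x h = - 2 * h $ i * R x ^ 2 + 4 * x $ i * (x \<bullet> h) * R x ^ 4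
     + deriv (deriv f) (Z x) * DZ x h * (\<delta> i * R x - x $ e * x $ i * R x ^ 3)
     + deriv f (Z x) * (- \<delta> i * (x \<bullet> h) * R x ^ 3 - h $ e * x $ i * R x ^ 3
         - x $ e * h $ i * R x ^ 3 + 3 * x $ e * x $ i * (x \<bullet> h) * R x ^ 5)"

lemma P_has_derivative:
  assumes x: "x \<noteq> 0"
  shows "(P i has_derivative Q i x) (at x)"
proof -
  note dR = inverse_norm_has_derivative[OF x]
  have R_pow: "((\<lambda>x. R x ^ n) has_derivative (\<lambda>h. - (real n * (x \<bullet> h) * R x ^ (n + 2)))) (at x)" for n
  proof (cases n)
    case (Suc k)
    show ?thesis
      by (rule has_derivative_eq_rhs[OF has_derivative_power[OF dR]])
        (auto simp: Suc power_add power2_eq_square power3_eq_cube)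
  qed simp
  have d1: "((\<lambda>x. x $ i * R x ^ 2) has_derivative (\<lambda>h. x $ i * - (2 * (x \<bullet> h) * R x ^ 4) + h $ i * R x ^ 2)) (at x)"
    using has_derivative_mult[OF has_derivative_component R_pow[of 2]] by simp
  have d2: "((\<lambda>x. x $ e * x $ i * R x ^ 3) has_derivative
     (\<lambda>h. x $ e * x $ i * - (3 * (x \<bullet> h) * R x ^ 5) + (x $ e * h $ i + h $ e * x $ i) * R x ^ 3)) (at x)"
    using has_derivative_mult[OF has_derivative_mult[OF has_derivative_component has_derivative_component] R_pow[of 3]]
    by simp
  have d3: "((\<lambda>x. \<delta> i * R x - x $ e * x $ i * R x ^ 3) has_derivative
     (\<lambda>h. \<delta> i * - ((x \<bullet> h) * R x ^ 3)
        - (x $ e * x $ i * - (3 * (x \<bullet> h) * R x ^ 5) + (x $ e * h $ i + h $ e * x $ i) * R x ^ 3))) (at x)"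
    by (rule has_derivative_diff[OF has_derivative_mult_right[OF dR] d2])
  have d4: "((\<lambda>x. deriv f (Z x)) has_derivative (\<lambda>h. DZ x h * deriv (deriv f) (Z x))) (at x)"
    by (rule DERIV_compose_FDERIV[OF f_deriv2 Z_has_derivative[OF x]])
  show ?thesis unfolding P_def[abs_def]
    by (rule has_derivative_eq_rhs[OF has_derivative_add[OF has_derivative_mult_right[OF d1] has_derivative_mult[OF d4 d3]]])
      (simp add: Q_def fun_eq_iff algebra_simps)
qed

lemma open_punctured: "open (- {0 :: real^'n})" by auto

lemma second_partial_U:
  assumes "x \<noteq> 0"
  shows "partial_deriv j (partial_deriv i U) x = Q i x (axis j 1)"
proof -
  have "partial_deriv j (partial_deriv i U) x = partial_deriv j (P i) x"
    by (rule partial_deriv_cong[OF open_punctured]) (use assms partial_U in auto)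
  then show ?thesis using has_derivative_imp_partial_deriv[OF P_has_derivative[OF assms]] by simp
qed

lemma C2_U: "C_k_on 2 U (- {0})"
proof -
  have "partial_deriv i U differentiable (at x)" if "x \<noteq> 0" for i x
  proof -
    have "(partial_deriv i U has_derivative Q i x) (at x)"
      by (rule has_derivative_transform_within_open[OF P_has_derivative[OF that] open_punctured])
        (use that partial_U in auto)
    then show ?thesis by (auto simp: differentiable_def)
  qed
  moreover have "continuous_on (- {0}) (partial_deriv j (partial_deriv i U))" for i j
  proof -
    have R: "continuous_on (- {0}) R" by (intro continuous_intros) auto
    have Z: "continuous_on (- {0}) Z" by (intro continuous_on_mult continuous_on_component R)
    have f1: "continuous_on I (deriv f)" and f2: "continuous_on I (deriv (deriv f))"
      using smooth[of "Suc 0"] smooth[of "Suc (Suc 0)"] by auto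
    have g1: "continuous_on (- {0}) (\<lambda>x. deriv f (Z x))"
      by (rule continuous_on_compose2[OF f1 Z]) (use Z_in_I in blast)
    have g2: "continuous_on (- {0}) (\<lambda>x. deriv (deriv f) (Z x))"
      by (rule continuous_on_compose2[OF f2 Z]) (use Z_in_I in blast)
    have "continuous_on S (\<lambda>x. - 2 * axis j 1 $ i * r x ^ 2 + 4 * x $ i * (x \<bullet> axis j 1) * r x ^ 4
     + h x * (axis j 1 $ e * r x - x $ e * (x \<bullet> axis j 1) * r x ^ 3) * (\<delta> i * r x - x $ e * x $ i * r x ^ 3)
     + g x * (- \<delta> i * (x \<bullet> axis j 1) * r x ^ 3 - axis j 1 $ e * x $ i * r x ^ 3
         - x $ e * axis j 1 $ i * r x ^ 3 + 3 * x $ e * x $ i * (x \<bullet> axis j 1) * r x ^ 5))"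
      if "continuous_on S r" "continuous_on S g" "continuous_on S h" for S and r g h :: "real^'n \<Rightarrow> real"
      by (intro continuous_intros continuous_on_component that)
    from this[OF R g1 g2] have "continuous_on (- {0}) (\<lambda>x. Q i x (axis j 1))"
      unfolding Q_def DZ_def .
    then show ?thesis by (rule continuous_on_eq) (simp add: second_partial_U)
  qed
  moreover have "U differentiable (at x)" if "x \<noteq> 0" for x
    using U_has_derivative[OF that] unfolding differentiable_def by blast
  ultimately show ?thesis unfolding numeral_2_eq_2 C_k_on.simps by blast
qed

text \<open>Trace of the closed form \<open>Q\<close> of the second derivative. The logarithm
  contributes \<open>- 2 * (N - 2)\<close>, and the rest is the Laplace-Beltrami operator of the
  sphere on functions of the height \<open>Z x\<close>, both divided by the square of the
  norm.\<close>

lemma laplacian_U: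
  assumes x: "x \<noteq> 0"
  shows "laplacian U x = R x ^ 2 * (- 2 * (real CARD('n) - 2) + (1 - (Z x)\<^sup>2) * deriv (deriv f) (Z x)
     - (real CARD('n) - 1) * Z x * deriv f (Z x))"
proof -
  let ?N = "real CARD('n)"
  define r where "r = R x"
  define y where "y = x $ e"
  define f1 where "f1 = deriv f (Z x)"
  define f2 where "f2 = deriv (deriv f) (Z x)"
  have sum_sq: "(\<Sum>i\<in>UNIV. (x $ i)\<^sup>2) * r\<^sup>2 = 1"
  proof -
    have "(\<Sum>i\<in>UNIV. (x $ i)\<^sup>2) = (norm x)\<^sup>2"
      unfolding power2_norm_eq_inner by (simp add: inner_vec_def power2_eq_square)
    then show ?thesis using x by (simp add: r_def power_inverse)
  qed
  have q: "Q i x (axis i 1) = (- 2 * r\<^sup>2 - f1 * y * r ^ 3)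
      + (4 * r ^ 4 + f2 * y\<^sup>2 * r ^ 6 + 3 * f1 * y * r ^ 5) * (x $ i)\<^sup>2
      + (if i = e then f2 * (r\<^sup>2 - 2 * y\<^sup>2 * r ^ 4) - 2 * f1 * y * r ^ 3 else 0)" for i
    unfolding Q_def DZ_def unfolding f1_def[symmetric] f2_def[symmetric]
    unfolding r_def[symmetric] y_def[symmetric]
    by (cases "i = e") (simp_all add: axis_one y_def[symmetric] algebra_simps eval_nat_numeral)
  have "laplacian U x = (\<Sum>i\<in>UNIV. Q i x (axis i 1))"
    unfolding laplacian_def by (simp add: second_partial_U[OF x])
  also have "\<dots> = ?N * (- 2 * r\<^sup>2 - f1 * y * r ^ 3)
      + (4 * r ^ 4 + f2 * y\<^sup>2 * r ^ 6 + 3 * f1 * y * r ^ 5) * (\<Sum>i\<in>UNIV. (x $ i)\<^sup>2)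
      + (f2 * (r\<^sup>2 - 2 * y\<^sup>2 * r ^ 4) - 2 * f1 * y * r ^ 3)"
    unfolding q by (simp add: sum.distrib sum_distrib_left)
  also have "(4 * r ^ 4 + f2 * y\<^sup>2 * r ^ 6 + 3 * f1 * y * r ^ 5) * (\<Sum>i\<in>UNIV. (x $ i)\<^sup>2)
     = (4 * r\<^sup>2 + f2 * y\<^sup>2 * r ^ 4 + 3 * f1 * y * r ^ 3) * ((\<Sum>i\<in>UNIV. (x $ i)\<^sup>2) * r\<^sup>2)"
    by (simp add: algebra_simps eval_nat_numeral)
  also have "?N * (- 2 * r\<^sup>2 - f1 * y * r ^ 3)
      + (4 * r\<^sup>2 + f2 * y\<^sup>2 * r ^ 4 + 3 * f1 * y * r ^ 3) * ((\<Sum>i\<in>UNIV. (x $ i)\<^sup>2) * r\<^sup>2)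
      + (f2 * (r\<^sup>2 - 2 * y\<^sup>2 * r ^ 4) - 2 * f1 * y * r ^ 3)
     = r\<^sup>2 * (- 2 * (?N - 2) + (1 - (y * r)\<^sup>2) * f2 - (?N - 1) * (y * r) * f1)"
    unfolding sum_sq by (simp add: algebra_simps eval_nat_numeral)
  finally show ?thesis by (simp add: r_def y_def f1_def f2_def)
qed

lemma classical_solution_U:
  assumes ode: "\<And>z. z \<in> {-1..1} \<Longrightarrow> (1 - z\<^sup>2) * deriv (deriv f) z - (real CARD('n) - 1) * z * deriv f z
      + 2 * (real CARD('n) - 2) * (exp (f z) - 1) = 0"
    and c: "c = ln (2 * (real CARD('n) - 2))" and N: "2 < CARD('n)"
  shows "classical_solution U"
  unfolding classical_solution_def
proof (intro conjI allI impI C2_U)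
  fix x :: "real^'n" assume x: "x \<noteq> 0"
  have "exp (- 2 * ln (norm x)) = R x ^ 2"
  proof -
    have "- 2 * ln (norm x) = - (ln (norm x) + ln (norm x))" by simp
    then have "exp (- 2 * ln (norm x)) = exp (- (ln (norm x) + ln (norm x)))" by (rule arg_cong)
    then show ?thesis unfolding exp_minus exp_add using x by (simp add: power2_eq_square)
  qed
  moreover have "exp c = 2 * (real CARD('n) - 2)" unfolding c using N by simp
  ultimately have "exp (U x) = R x ^ 2 * (2 * (real CARD('n) - 2) * exp (f (Z x)))"
    unfolding U_def exp_add by (simp only: mult.assoc)
  then have "laplacian U x + exp (U x) = R x ^ 2 * ((1 - (Z x)\<^sup>2) * deriv (deriv f) (Z x)
     - (real CARD('n) - 1) * Z x * deriv f (Z x) + 2 * (real CARD('n) - 2) * (exp (f (Z x)) - 1))"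
    unfolding laplacian_U[OF x] by (simp add: distrib_left right_diff_distrib)
  then show "laplacian U x + exp (U x) = 0" using ode[OF Z_mem[of x]] by simp
qed

lemma U_at_top: "filterlim U at_top (at 0)"
  unfolding filterlim_at_top
proof
  fix B :: real
  have "continuous_on {-1..1} f"
    using smooth[of 0] continuous_on_subset[OF _ I(2)] by simp
  then have "bounded (f ` {-1..1})"
    by (rule compact_imp_bounded[OF compact_continuous_image]) simp
  then obtain M where "\<forall>z\<in>{-1..1}. \<bar>f z\<bar> \<le> M"
    unfolding bounded_iff by auto
  then have M: "\<bar>f z\<bar> \<le> M" if "z \<in> {-1..1}" for z using that by blast
  \<comment> \<open>The radius at which the lower bound \<open>- 2 * ln d + c - M\<close> equals
    \<open>B\<close>.\<close>
  define d where "d = exp ((c - M - B) / 2)"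
  have "B \<le> U x" if "x \<noteq> 0" "dist x 0 < d" for x
  proof -
    have "ln (norm x) < ln d"
      using that by (subst ln_less_cancel_iff) (simp_all add: d_def)
    then have "2 * ln (norm x) < c - M - B" by (simp add: d_def)
    moreover have "- M \<le> f (Z x)" using M[OF Z_mem[of x]] by linarith
    ultimately show ?thesis unfolding U_def by linarith
  qed
  moreover have "0 < d" by (simp add: d_def)
  ultimately show "\<forall>\<^sub>F x in at 0. B \<le> U x"
    unfolding eventually_at by blast
qed

lemma smooth_on_sphere_profile: "smooth_on_sphere (\<lambda>\<sigma> :: real^'n. f (\<sigma> $ e))"
  unfolding smooth_on_sphere_def
proof
  fix p :: "real^'n" assume p: "p \<in> sphere 0 1"
  let ?W = "{y :: real^'n. y $ e \<in> I}"
  have W: "open ?W" by (rule open_component_vimage[OF I(1)])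
  have "p $ e \<in> I" using Z_in_I[of p] p by simp
  moreover have "C_k_on k (\<lambda>y :: real^'n. f (y $ e)) ?W" for k
    using C_k_on_compose_component[OF I(1) smooth, of k 1] by simp
  ultimately show "\<exists>W g. open W \<and> p \<in> W \<and> (\<forall>k. C_k_on k g W) \<and> (\<forall>\<sigma>\<in>W \<inter> sphere 0 1. g \<sigma> = f (\<sigma> $ e))"
    using W by (intro exI[of _ ?W] exI[of _ "\<lambda>y. f (y $ e)"]) simp
qed

text \<open>A constant solution of the profile equation satisfies \<open>exp (f 1) = 1\<close>, so
  its value is 0; the equation is evaluated at the interior point 0.\<close>

lemma profile_nonconstant:
  assumes ode: "\<And>z. z \<in> {-1..1} \<Longrightarrow> (1 - z\<^sup>2) * deriv (deriv f) z - b * z * deriv f z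
      + k * (exp (f z) - 1) = 0" and "k \<noteq> 0" and "f 1 \<noteq> 0"
    and const: "\<And>z. z \<in> {-1..1} \<Longrightarrow> f z = f 1"
  shows False
proof -
  have S: "open {-1<..<1::real}" by simp
  have d1: "deriv f z = 0" if z: "z \<in> {-1<..<1}" for z
  proof (rule DERIV_imp_deriv, rule has_field_derivative_transform_within_open[OF DERIV_const S z])
    show "f 1 = f y" if "y \<in> {-1<..<1}" for y
      by (rule const[symmetric]) (use that in auto)
  qed
  have "deriv (deriv f) 0 = 0"
    by (rule DERIV_imp_deriv, rule has_field_derivative_transform_within_open[OF DERIV_const S, of _ 0])
      (auto simp: d1)
  then have "k * (exp (f 1) - 1) = 0" using ode[of 0] const[of 0] by simp
  then show False using assms(2,3) by simp
qed

end

section \<open>Assembly of the sequence of solutions\<close>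

lemma ex_sphere_component:
  fixes e e' :: "'n::finite"
  assumes "e' \<noteq> e" "z \<in> {-1..1}"
  shows "\<exists>\<sigma> :: real^'n. norm \<sigma> = 1 \<and> \<sigma> $ e = z"
proof -
  define \<sigma> :: "real^'n" where "\<sigma> = z *\<^sub>R axis e 1 + sqrt (1 - z\<^sup>2) *\<^sub>R axis e' 1"
  have z: "z\<^sup>2 \<le> 1" using assms(2) by (simp add: abs_square_le_1 abs_le_iff)
  have "\<sigma> \<bullet> \<sigma> = z * z + sqrt (1 - z\<^sup>2) * sqrt (1 - z\<^sup>2)"
    using assms(1) by (simp add: \<sigma>_def inner_add_left inner_add_right inner_axis_axis)
  also have "\<dots> = 1" using z by (simp add: power2_eq_square)
  finally have "norm \<sigma> = 1" by (simp add: norm_eq_sqrt_inner)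
  moreover have "\<sigma> $ e = z" using assms(1) by (simp add: \<sigma>_def axis_def)
  ultimately show ?thesis by blast
qed

theorem theorem1:
  assumes "4 \<le> CARD('n::finite)" and "CARD('n) \<le> 10"
  shows "\<exists>(U :: nat \<Rightarrow> real^'n \<Rightarrow> real) (V :: nat \<Rightarrow> real^'n \<Rightarrow> real).
    (\<forall>j. classical_solution (U j) \<and>
         \<not> radial (U j) \<and>
         smooth_on_sphere (V j) \<and>
         \<not> V j constant_on sphere 0 1 \<and>
         (\<forall>R>0. \<forall>\<sigma>\<in>sphere 0 1.
            U j (R *\<^sub>R \<sigma>) = - 2 * ln R + ln (2 * (real CARD('n) - 2)) + V j \<sigma>) \<and>
         filterlim (U j) at_top (at 0)) \<and>
    (\<forall>j k. j \<noteq> k \<longrightarrow> (\<exists>x. x \<noteq> 0 \<and> U j x \<noteq> U k x))"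
proof -
  define m where "m = CARD('n) - 3"
  have m: "1 \<le> m" "m \<le> 7" "real m = real CARD('n) - 3" using assms by (auto simp: m_def)
  \<comment> \<open>Any coordinate axis can be the polar axis. The second axis \<open>e'\<close>
    supplies points of the sphere at every height, so that constancy on the sphere becomes constancy
    of the profile.\<close>
  obtain e :: 'n where True by blast
  have "CARD('n) \<noteq> card {e}" using assms by simp
  then obtain e' where ee: "e' \<noteq> e" by (metis UNIV_eq_I singletonI)
  define c where "c = ln (2 * (real CARD('n) - 2))"
  obtain f :: "nat \<Rightarrow> real \<Rightarrow> real" where inj: "inj (\<lambda>k. f k 1)" and f: "\<forall>k. 1 \<le> f k 1 \<and>
    (\<exists>I. open I \<and> {-1..1} \<subseteq> I \<and> (\<forall>n. smooth_upto n (f k) I) \<and>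
      (\<forall>z\<in>{-1..1}. (1 - z\<^sup>2) * deriv (deriv (f k)) z - (real m + 2) * z * deriv (f k) z
         + 2 * (real m + 1) * (exp (f k z) - 1) = 0))"
    using ex_profiles[OF m(1,2)] by (elim exE conjE)
  define Us :: "nat \<Rightarrow> real^'n \<Rightarrow> real" where "Us k = homogeneous_profile.U (f k) e c" for k
  define Vs :: "nat \<Rightarrow> real^'n \<Rightarrow> real" where "Vs k \<sigma> = f k (\<sigma> $ e)" for k \<sigma>
  have "classical_solution (Us j) \<and> \<not> radial (Us j) \<and> smooth_on_sphere (Vs j) \<and>
         \<not> Vs j constant_on sphere 0 1 \<and>
         (\<forall>R>0. \<forall>\<sigma>\<in>sphere 0 1. Us j (R *\<^sub>R \<sigma>) = - 2 * ln R + c + Vs j \<sigma>) \<and>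
         filterlim (Us j) at_top (at 0)" (is "?A \<and> ?B \<and> ?C \<and> ?D \<and> ?E \<and> ?F") for j
  proof -
    obtain I where IJ: "open I" "{-1..1} \<subseteq> I" "\<forall>n. smooth_upto n (f j) I"
      "\<forall>z\<in>{-1..1}. (1 - z\<^sup>2) * deriv (deriv (f j)) z - (real m + 2) * z * deriv (f j) z
         + 2 * (real m + 1) * (exp (f j z) - 1) = 0" and one: "1 \<le> f j 1"
      using f by blast
    interpret homogeneous_profile "f j" I e c by unfold_locales (use IJ in auto)
    have "real m + 2 = real CARD('n) - 1" "real m + 1 = real CARD('n) - 2" using m(3) by auto
    then have ode: "(1 - z\<^sup>2) * deriv (deriv (f j)) z - (real CARD('n) - 1) * z * deriv (f j) z
         + 2 * (real CARD('n) - 2) * (exp (f j z) - 1) = 0" if "z \<in> {-1..1}" for z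
      using IJ(4) that by metis
    have A: ?A unfolding Us_def using assms by (intro classical_solution_U ode c_def) auto
    have C: ?C unfolding Vs_def by (rule smooth_on_sphere_profile)
    have F: ?F unfolding Us_def by (rule U_at_top)
    have E: ?E
    proof (intro allI impI ballI)
      fix R :: real and \<sigma> :: "real^'n" assume "R > 0" "\<sigma> \<in> sphere 0 1"
      then have "Us j (R *\<^sub>R \<sigma>) = - 2 * ln R + c + f j (R * \<sigma> $ e * inverse R)"
        by (simp add: Us_def homogeneous_profile.U_def[OF homogeneous_profile_axioms])
      also have "R * \<sigma> $ e * inverse R = \<sigma> $ e" using \<open>R > 0\<close> by simp
      finally show "Us j (R *\<^sub>R \<sigma>) = - 2 * ln R + c + Vs j \<sigma>" by (simp add: Vs_def)
    qed
    have D: ?D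
    proof
      assume "Vs j constant_on sphere 0 1"
      then obtain v where v: "\<And>\<sigma>. \<sigma> \<in> sphere 0 1 \<Longrightarrow> Vs j \<sigma> = v" by (auto simp: constant_on_def)
      have "f j z = v" if "z \<in> {-1..1}" for z
        using ex_sphere_component[OF ee that] v by (auto simp: Vs_def)
      then show False using profile_nonconstant[OF ode] one assms by simp
    qed
    have B: ?B
    proof
      assume "radial (Us j)"
      then obtain \<phi> where \<phi>: "\<And>x. x \<noteq> 0 \<Longrightarrow> Us j x = \<phi> (norm x)" by (auto simp: radial_def)
      have "Vs j \<sigma> = \<phi> 1 - c" if \<sigma>: "\<sigma> \<in> sphere 0 1" for \<sigma>
      proof -
        have "\<sigma> \<noteq> 0" using \<sigma> by auto
        then have "Us j \<sigma> = \<phi> 1" using \<phi>[of \<sigma>] \<sigma> by simp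
        moreover have "Us j \<sigma> = c + Vs j \<sigma>" using E[rule_format, of 1 \<sigma>] \<sigma> by simp
        ultimately show ?thesis by simp
      qed
      then have "Vs j constant_on sphere 0 1" by (auto simp: constant_on_def)
      then show False using D by simp
    qed
    show ?thesis using A B C D E F by blast
  qed
  note props = this
  have distinct: "\<exists>x. x \<noteq> 0 \<and> Us j x \<noteq> Us k x" if "j \<noteq> k" for j k
  proof -
    let ?x = "axis e 1 :: real^'n"
    have x: "?x \<in> sphere 0 1" by simp
    have val: "Us i ?x = c + f i 1" for i
    proof -
      have "\<forall>R>0. \<forall>\<sigma>\<in>sphere 0 1. Us i (R *\<^sub>R \<sigma>) = - 2 * ln R + c + Vs i \<sigma>"
        using props[of i] by (elim conjE)
      from this[rule_format, OF zero_less_one x] show ?thesis by (simp add: Vs_def axis_one)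
    qed
    have "f j 1 \<noteq> f k 1" using injD[OF inj, of j k] that by blast
    then have "Us j ?x \<noteq> Us k ?x" by (simp add: val)
    moreover have "?x \<noteq> 0" by (simp add: axis_eq_0_iff)
    ultimately show ?thesis by blast
  qed
  show ?thesis
  proof (rule exI[of _ Us], rule exI[of _ Vs], rule conjI)
    show "\<forall>j k. j \<noteq> k \<longrightarrow> (\<exists>x. x \<noteq> 0 \<and> Us j x \<noteq> Us k x)"
      by (intro allI impI) (rule distinct)
  qed (rule allI, rule props[unfolded c_def])
qed

end
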